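(* Let $\mathcal{C}$ be a finitely complete category. Then $\mathcal{C}$ is a pretopos if and only if $\mathcal{C}$ is diexact and has a strict initial object.
   Context: A span $f \colon A \leftarrow C \rightarrow B \colon g$ in a finitely complete category is called a Mal'cev span if it is jointly monic and there exists a morphism $m \colon C \times_B C \times_A C \to C$ with $f m = f\pi_1$ and $g m = g \pi_3$. Here $C \times_B C \times_A C$ is the limit object whose generalized elements are triples $(c_1,c_2,c_3)$ of generalized elements of $C$ with $g c_1 = g c_2$ and $f c_2 = f c_3$, and $\pi_1, \pi_3$ are its first and third projections to $C$. A pushout square with vertex $D$ is stable under pullback if, for every morphism $X \to D$, the square obtained by pulling back the whole square along $X \to D$ is again a pushout. A finitely complete category is diexact if every Mal'cev span in it admits a pushout, and every such pushout square (a pushout of a Mal'cev span) is stable under pullback and is itself a pullback square. A pretopos is a finitely complete category which is both (finitary) extensive, i.e. has finite coproducts which are disjoint and stable under pullback, and Barr-exact, i.e. is regular and every equivalence relation is a kernel-pair. An initial object $0$ is strict if every morphism with codomain $0$ is invertible. *)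

theory Defs
  imports Main
begin

text \<open>A category is given by a set of objects and a set of arrows, possibly smaller than the
  ambient types; the operations are unspecified outside these sets, and \<open>g \<cdot> f\<close> is unspecified
  unless \<open>Cod f = Dom g\<close>.\<close>

record ('o, 'a) cat =
  Obj :: "'o set"
  Arr :: "'a set"
  Dom :: "'a \<Rightarrow> 'o"
  Cod :: "'a \<Rightarrow> 'o"
  Id :: "'o \<Rightarrow> 'a"
  Comp :: "'a \<Rightarrow> 'a \<Rightarrow> 'a" (infixl "\<cdot>\<index>" 70)

definition Hom :: "('o, 'a, 'm) cat_scheme \<Rightarrow> 'o \<Rightarrow> 'o \<Rightarrow> 'a set"
  where "Hom C A B = {f \<in> Arr C. Dom C f = A \<and> Cod C f = B}"

locale category =
  fixes C :: "('o, 'a, 'm) cat_scheme" (structure)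
  assumes Dom_in_Obj: "f \<in> Arr C \<Longrightarrow> Dom C f \<in> Obj C"
    and Cod_in_Obj: "f \<in> Arr C \<Longrightarrow> Cod C f \<in> Obj C"
    and Id_in_Hom: "A \<in> Obj C \<Longrightarrow> Id C A \<in> Hom C A A"
    and Comp_in_Hom: "f \<in> Hom C A B \<Longrightarrow> g \<in> Hom C B D \<Longrightarrow> g \<cdot> f \<in> Hom C A D"
    and Comp_Id: "f \<in> Hom C A B \<Longrightarrow> f \<cdot> Id C A = f"
    and Id_Comp: "f \<in> Hom C A B \<Longrightarrow> Id C B \<cdot> f = f"
    and Comp_assoc:
      "f \<in> Hom C A B \<Longrightarrow> g \<in> Hom C B D \<Longrightarrow> h \<in> Hom C D E \<Longrightarrow> h \<cdot> (g \<cdot> f) = (h \<cdot> g) \<cdot> f"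

definition monic :: "('o, 'a, 'm) cat_scheme \<Rightarrow> 'a \<Rightarrow> bool"
  where "monic C f \<longleftrightarrow> f \<in> Arr C \<and>
    (\<forall>X \<in> Obj C. \<forall>u \<in> Hom C X (Dom C f). \<forall>v \<in> Hom C X (Dom C f).
      Comp C f u = Comp C f v \<longrightarrow> u = v)"

definition invertible :: "('o, 'a, 'm) cat_scheme \<Rightarrow> 'a \<Rightarrow> bool"
  where "invertible C f \<longleftrightarrow> f \<in> Arr C \<and>
    (\<exists>g \<in> Hom C (Cod C f) (Dom C f).
      Comp C g f = Id C (Dom C f) \<and> Comp C f g = Id C (Cod C f))"

definition is_functor ::
  "('i, 'j, 'n) cat_scheme \<Rightarrow> ('o, 'a, 'm) cat_scheme \<Rightarrow> ('i \<Rightarrow> 'o) \<Rightarrow> ('j \<Rightarrow> 'a) \<Rightarrow> bool"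
  where "is_functor J C Fo Fa \<longleftrightarrow>
    (\<forall>i \<in> Obj J. Fo i \<in> Obj C \<and> Fa (Id J i) = Id C (Fo i)) \<and>
    (\<forall>u \<in> Arr J. Fa u \<in> Hom C (Fo (Dom J u)) (Fo (Cod J u))) \<and>
    (\<forall>u \<in> Arr J. \<forall>v \<in> Arr J. Cod J u = Dom J v \<longrightarrow> Fa (Comp J v u) = Comp C (Fa v) (Fa u))"

definition is_cone ::
  "('i, 'j, 'n) cat_scheme \<Rightarrow> ('o, 'a, 'm) cat_scheme \<Rightarrow> ('i \<Rightarrow> 'o) \<Rightarrow> ('j \<Rightarrow> 'a)
    \<Rightarrow> 'o \<Rightarrow> ('i \<Rightarrow> 'a) \<Rightarrow> bool"
  where "is_cone J C Fo Fa X t \<longleftrightarrow> X \<in> Obj C \<and>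
    (\<forall>i \<in> Obj J. t i \<in> Hom C X (Fo i)) \<and>
    (\<forall>u \<in> Arr J. Comp C (Fa u) (t (Dom J u)) = t (Cod J u))"

definition is_limit ::
  "('i, 'j, 'n) cat_scheme \<Rightarrow> ('o, 'a, 'm) cat_scheme \<Rightarrow> ('i \<Rightarrow> 'o) \<Rightarrow> ('j \<Rightarrow> 'a)
    \<Rightarrow> 'o \<Rightarrow> ('i \<Rightarrow> 'a) \<Rightarrow> bool"
  where "is_limit J C Fo Fa L p \<longleftrightarrow> is_cone J C Fo Fa L p \<and>
    (\<forall>X t. is_cone J C Fo Fa X t \<longrightarrow>
      (\<exists>!w. w \<in> Hom C X L \<and> (\<forall>i \<in> Obj J. Comp C (p i) w = t i)))"

text \<open>Every finite category is isomorphic to one whose objects and arrows are natural numbers,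
  so these suffice as shapes of finite diagrams.\<close>

definition finitely_complete :: "('o, 'a, 'm) cat_scheme \<Rightarrow> bool"
  where "finitely_complete C \<longleftrightarrow>
    (\<forall>(J :: (nat, nat) cat) Fo Fa.
      category J \<and> finite (Obj J) \<and> finite (Arr J) \<and> is_functor J C Fo Fa \<longrightarrow>
      (\<exists>L p. is_limit J C Fo Fa L p))"

definition is_initial :: "('o, 'a, 'm) cat_scheme \<Rightarrow> 'o \<Rightarrow> bool"
  where "is_initial C Z \<longleftrightarrow> Z \<in> Obj C \<and> (\<forall>X \<in> Obj C. \<exists>!w. w \<in> Hom C Z X)"

definition is_strict_initial :: "('o, 'a, 'm) cat_scheme \<Rightarrow> 'o \<Rightarrow> bool"
  where "is_strict_initial C Z \<longleftrightarrow>
    is_initial C Z \<and> (\<forall>f \<in> Arr C. Cod C f = Z \<longrightarrow> invertible C f)"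

text \<open>The square with sides \<open>p : P \<rightarrow> A\<close>, \<open>q : P \<rightarrow> B\<close>, \<open>h : A \<rightarrow> D\<close>, \<open>k : B \<rightarrow> D\<close> commutes.\<close>

definition comm_square :: "('o, 'a, 'm) cat_scheme \<Rightarrow> 'a \<Rightarrow> 'a \<Rightarrow> 'a \<Rightarrow> 'a \<Rightarrow> bool"
  where "comm_square C p q h k \<longleftrightarrow> p \<in> Arr C \<and> q \<in> Arr C \<and> h \<in> Arr C \<and> k \<in> Arr C \<and>
    Dom C p = Dom C q \<and> Cod C p = Dom C h \<and> Cod C q = Dom C k \<and> Cod C h = Cod C k \<and>
    Comp C h p = Comp C k q"

definition is_pullback :: "('o, 'a, 'm) cat_scheme \<Rightarrow> 'a \<Rightarrow> 'a \<Rightarrow> 'a \<Rightarrow> 'a \<Rightarrow> bool"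
  where "is_pullback C p q h k \<longleftrightarrow> comm_square C p q h k \<and>
    (\<forall>u v. comm_square C u v h k \<longrightarrow>
      (\<exists>!w. w \<in> Hom C (Dom C u) (Dom C p) \<and> Comp C p w = u \<and> Comp C q w = v))"

definition is_pushout :: "('o, 'a, 'm) cat_scheme \<Rightarrow> 'a \<Rightarrow> 'a \<Rightarrow> 'a \<Rightarrow> 'a \<Rightarrow> bool"
  where "is_pushout C f g h k \<longleftrightarrow> comm_square C f g h k \<and>
    (\<forall>u v. comm_square C f g u v \<longrightarrow>
      (\<exists>!w. w \<in> Hom C (Cod C h) (Cod C u) \<and> Comp C w h = u \<and> Comp C w k = v))"

definition is_coequalizer :: "('o, 'a, 'm) cat_scheme \<Rightarrow> 'a \<Rightarrow> 'a \<Rightarrow> 'a \<Rightarrow> bool"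
  where "is_coequalizer C r s e \<longleftrightarrow>
    r \<in> Arr C \<and> s \<in> Hom C (Dom C r) (Cod C r) \<and>
    e \<in> Arr C \<and> Dom C e = Cod C r \<and> Comp C e r = Comp C e s \<and>
    (\<forall>t \<in> Arr C. Dom C t = Cod C r \<and> Comp C t r = Comp C t s \<longrightarrow>
      (\<exists>!w. w \<in> Hom C (Cod C e) (Cod C t) \<and> Comp C w e = t))"

definition is_coproduct ::
  "('o, 'a, 'm) cat_scheme \<Rightarrow> 'i set \<Rightarrow> ('i \<Rightarrow> 'o) \<Rightarrow> 'o \<Rightarrow> ('i \<Rightarrow> 'a) \<Rightarrow> bool"
  where "is_coproduct C I X S inc \<longleftrightarrow>
    S \<in> Obj C \<and> (\<forall>i \<in> I. X i \<in> Obj C \<and> inc i \<in> Hom C (X i) S) \<and>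
    (\<forall>T t. T \<in> Obj C \<and> (\<forall>i \<in> I. t i \<in> Hom C (X i) T) \<longrightarrow>
      (\<exists>!w. w \<in> Hom C S T \<and> (\<forall>i \<in> I. Comp C w (inc i) = t i)))"

definition is_span :: "('o, 'a, 'm) cat_scheme \<Rightarrow> 'a \<Rightarrow> 'a \<Rightarrow> bool"
  where "is_span C f g \<longleftrightarrow> f \<in> Arr C \<and> g \<in> Arr C \<and> Dom C f = Dom C g"

definition jointly_monic :: "('o, 'a, 'm) cat_scheme \<Rightarrow> 'a \<Rightarrow> 'a \<Rightarrow> bool"
  where "jointly_monic C f g \<longleftrightarrow> is_span C f g \<and>
    (\<forall>X \<in> Obj C. \<forall>u \<in> Hom C X (Dom C f). \<forall>v \<in> Hom C X (Dom C f).
      Comp C f u = Comp C f v \<and> Comp C g u = Comp C g v \<longrightarrow> u = v)"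

text \<open>A triple of generalized elements \<open>c1, c2, c3 : X \<rightarrow> dom f\<close> with \<open>g c1 = g c2\<close> and
  \<open>f c2 = f c3\<close>.\<close>

definition zigzag ::
  "('o, 'a, 'm) cat_scheme \<Rightarrow> 'a \<Rightarrow> 'a \<Rightarrow> 'o \<Rightarrow> 'a \<Rightarrow> 'a \<Rightarrow> 'a \<Rightarrow> bool"
  where "zigzag C f g X c1 c2 c3 \<longleftrightarrow> X \<in> Obj C \<and>
    c1 \<in> Hom C X (Dom C f) \<and> c2 \<in> Hom C X (Dom C f) \<and> c3 \<in> Hom C X (Dom C f) \<and>
    Comp C g c1 = Comp C g c2 \<and> Comp C f c2 = Comp C f c3"

definition zigzag_limit ::
  "('o, 'a, 'm) cat_scheme \<Rightarrow> 'a \<Rightarrow> 'a \<Rightarrow> 'o \<Rightarrow> 'a \<Rightarrow> 'a \<Rightarrow> 'a \<Rightarrow> bool"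
  where "zigzag_limit C f g P p1 p2 p3 \<longleftrightarrow> zigzag C f g P p1 p2 p3 \<and>
    (\<forall>X c1 c2 c3. zigzag C f g X c1 c2 c3 \<longrightarrow>
      (\<exists>!w. w \<in> Hom C X P \<and> Comp C p1 w = c1 \<and> Comp C p2 w = c2 \<and> Comp C p3 w = c3))"

definition malcev_span :: "('o, 'a, 'm) cat_scheme \<Rightarrow> 'a \<Rightarrow> 'a \<Rightarrow> bool"
  where "malcev_span C f g \<longleftrightarrow> jointly_monic C f g \<and>
    (\<exists>P p1 p2 p3 m. zigzag_limit C f g P p1 p2 p3 \<and> m \<in> Hom C P (Dom C f) \<and>
      Comp C f m = Comp C f p1 \<and> Comp C g m = Comp C g p3)"

text \<open>The square \<open>h f = k g\<close> with vertex \<open>D\<close> is pulled back along \<open>x : X \<rightarrow> D\<close>: the objects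
  \<open>A\<close>, \<open>B\<close>, \<open>C\<close> are replaced by their pullbacks along \<open>x\<close>, whose projections are \<open>a, h'\<close>,
  \<open>b, k'\<close> and \<open>c, l\<close> respectively, and \<open>f'\<close>, \<open>g'\<close> are the maps over \<open>X\<close> induced by \<open>f\<close>, \<open>g\<close>.\<close>

definition stable_pushout :: "('o, 'a, 'm) cat_scheme \<Rightarrow> 'a \<Rightarrow> 'a \<Rightarrow> 'a \<Rightarrow> 'a \<Rightarrow> bool"
  where "stable_pushout C f g h k \<longleftrightarrow> is_pushout C f g h k \<and>
    (\<forall>x a h' b k' c l f' g'.
      is_pullback C a h' h x \<and> is_pullback C b k' k x \<and> is_pullback C c l (Comp C h f) x \<and>
      f' \<in> Hom C (Dom C c) (Dom C a) \<and> Comp C a f' = Comp C f c \<and> Comp C h' f' = l \<and>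
      g' \<in> Hom C (Dom C c) (Dom C b) \<and> Comp C b g' = Comp C g c \<and> Comp C k' g' = l \<longrightarrow>
      is_pushout C f' g' h' k')"

definition diexact :: "('o, 'a, 'm) cat_scheme \<Rightarrow> bool"
  where "diexact C \<longleftrightarrow> finitely_complete C \<and>
    (\<forall>f g. malcev_span C f g \<longrightarrow>
      (\<exists>h k. is_pushout C f g h k) \<and>
      (\<forall>h k. is_pushout C f g h k \<longrightarrow> stable_pushout C f g h k \<and> is_pullback C f g h k))"

definition has_finite_coproducts :: "('o, 'a, 'm) cat_scheme \<Rightarrow> bool"
  where "has_finite_coproducts C \<longleftrightarrow>
    (\<forall>(I :: nat set) X. finite I \<and> X ` I \<subseteq> Obj C \<longrightarrow> (\<exists>S inc. is_coproduct C I X S inc))"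

definition finite_coproducts_disjoint :: "('o, 'a, 'm) cat_scheme \<Rightarrow> bool"
  where "finite_coproducts_disjoint C \<longleftrightarrow>
    (\<forall>(I :: nat set) X S inc. finite I \<and> is_coproduct C I X S inc \<longrightarrow>
      (\<forall>i \<in> I. monic C (inc i)) \<and>
      (\<forall>i \<in> I. \<forall>j \<in> I. \<forall>p q. i \<noteq> j \<and> is_pullback C p q (inc i) (inc j) \<longrightarrow>
        is_initial C (Dom C p)))"

definition finite_coproducts_stable :: "('o, 'a, 'm) cat_scheme \<Rightarrow> bool"
  where "finite_coproducts_stable C \<longleftrightarrow>
    (\<forall>(I :: nat set) X S inc. finite I \<and> is_coproduct C I X S inc \<longrightarrow>
      (\<forall>x \<in> Arr C. \<forall>p q. Cod C x = S \<and> (\<forall>i \<in> I. is_pullback C (p i) (q i) (inc i) x) \<longrightarrow>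
        is_coproduct C I (\<lambda>i. Dom C (q i)) (Dom C x) q))"

text \<open>To be used for categories with pullbacks: the last two conditions quantify
  over pullbacks without asserting that they exist.\<close>

definition extensive :: "('o, 'a, 'm) cat_scheme \<Rightarrow> bool"
  where "extensive C \<longleftrightarrow>
    has_finite_coproducts C \<and> finite_coproducts_disjoint C \<and> finite_coproducts_stable C"

definition is_kernel_pair :: "('o, 'a, 'm) cat_scheme \<Rightarrow> 'a \<Rightarrow> 'a \<Rightarrow> 'a \<Rightarrow> bool"
  where "is_kernel_pair C r s f \<longleftrightarrow> is_pullback C r s f f"

definition regular_epi :: "('o, 'a, 'm) cat_scheme \<Rightarrow> 'a \<Rightarrow> bool"
  where "regular_epi C e \<longleftrightarrow> (\<exists>r s. is_coequalizer C r s e)"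

definition regular :: "('o, 'a, 'm) cat_scheme \<Rightarrow> bool"
  where "regular C \<longleftrightarrow> finitely_complete C \<and>
    (\<forall>r s f. is_kernel_pair C r s f \<longrightarrow> (\<exists>e. is_coequalizer C r s e)) \<and>
    (\<forall>p q e x. regular_epi C e \<and> is_pullback C p q e x \<longrightarrow> regular_epi C q)"

definition is_equivalence_relation :: "('o, 'a, 'm) cat_scheme \<Rightarrow> 'a \<Rightarrow> 'a \<Rightarrow> bool"
  where "is_equivalence_relation C r s \<longleftrightarrow> jointly_monic C r s \<and> Cod C r = Cod C s \<and>
    (\<exists>d \<in> Hom C (Cod C r) (Dom C r). Comp C r d = Id C (Cod C r) \<and> Comp C s d = Id C (Cod C r)) \<and>
    (\<exists>i \<in> Hom C (Dom C r) (Dom C r). Comp C r i = s \<and> Comp C s i = r) \<and>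
    (\<exists>p q t. is_pullback C p q s r \<and> t \<in> Hom C (Dom C p) (Dom C r) \<and>
      Comp C r t = Comp C r p \<and> Comp C s t = Comp C s q)"

definition barr_exact :: "('o, 'a, 'm) cat_scheme \<Rightarrow> bool"
  where "barr_exact C \<longleftrightarrow> regular C \<and>
    (\<forall>r s. is_equivalence_relation C r s \<longrightarrow> (\<exists>f. is_kernel_pair C r s f))"

definition pretopos :: "('o, 'a, 'm) cat_scheme \<Rightarrow> bool"
  where "pretopos C \<longleftrightarrow> finitely_complete C \<and> extensive C \<and> barr_exact C"

end

theory Submission
  imports Defs
begin

text \<open>In a diexact category with strict initial object \<open>0\<close>, every span with vertex \<open>0\<close> is a Mal'cev
  span and its pushout is a binary coproduct; stability and the pullback property give
  extensivity. An equivalence relation is a Mal'cev span whose pushout legs coincide because of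
  reflexivity, so the pushout is a coequalizer of which the relation is the kernel pair.

  Conversely, in a pretopos, a Mal'cev span \<open>A \<leftarrow> \<Gamma> \<rightarrow> B\<close> generates on \<open>S = A + B\<close> the relation
  \<open>1 \<union> \<Gamma> \<union> \<Gamma>\<degree> \<union> \<Gamma>\<Gamma>\<degree> \<union> \<Gamma>\<degree>\<Gamma>\<close>, which is transitive since \<open>\<Gamma>\<Gamma>\<degree>\<Gamma> = \<Gamma>\<close>. Generalized elements of this relation
  have a concrete description locally, on a cover by regular epimorphisms and coproduct
  injections, and a lift through a jointly monic pair may be constructed locally. The quotient
  \<open>q : S \<rightarrow> D\<close> gives the pushout, and the part of the relation between \<open>A\<close> and \<open>B\<close>, which is \<open>\<Gamma>\<close>,
  shows that the square is a pullback.
  For stability, \<open>q\<close> is pulled back along \<open>X \<rightarrow> D\<close>: the pulled back map is still a regular epimorphism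
  out of a coproduct, and locally its kernel pair is described by the pulled back span.\<close>

text \<open>No internal language is available, so arguments about elements are made for generalized
  elements \<open>u : X -> S\<close>. Two obstacles shape the pretopos half. First, a union of
  relations is not a union at each stage \<open>X\<close>: an element of the image of a coproduct
  comes from one of the summands only after restriction along a regular epimorphism and coproduct
  injections. This is why \<open>covers\<close> is needed, with one principle for checking equations
  on a cover (\<open>covers_eqI\<close>) and one for gluing lifts (\<open>covers_lift\<close>).
  Secondly, disjoint summands have no common element at a stage \<open>X\<close> unless
  \<open>X\<close> is initial. The combinatorics, which is a statement about plain sets, is
  therefore applied at non-initial stages; at initial ones uniqueness of arrows does the work.

  The pushout property of the quotient gets no separate proof: it is the case of pulling back along
  an identity. Diexactness speaks of every pushout while only one is constructed, so the result is
  finally moved along the comparison arrow.\<close>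

context category
begin

section \<open>Rewriting with composites; cancellation of monic arrows and pairs\<close>

lemma Hom_iff [simp]: "f \<in> Hom C A B \<longleftrightarrow> f \<in> Arr C \<and> Dom C f = A \<and> Cod C f = B"
  by (simp add: Hom_def)

lemma Comp_simps [simp]:
  assumes "f \<in> Arr C" "g \<in> Arr C" "Cod C f = Dom C g"
  shows "g \<cdot> f \<in> Arr C" "Dom C (g \<cdot> f) = Dom C f" "Cod C (g \<cdot> f) = Cod C g"
  using Comp_in_Hom[of f "Dom C f" "Dom C g" g "Cod C g"] assms by simp_all

lemma Id_simps [simp]:
  assumes "A \<in> Obj C"
  shows "Id C A \<in> Arr C" "Dom C (Id C A) = A" "Cod C (Id C A) = A"
  using Id_in_Hom[OF assms] by simp_all

lemma Comp_Id_simp [simp]: "f \<in> Arr C \<Longrightarrow> Dom C f = A \<Longrightarrow> f \<cdot> Id C A = f"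
  by (rule Comp_Id[where B = "Cod C f"]) simp

lemma Id_Comp_simp [simp]: "f \<in> Arr C \<Longrightarrow> Cod C f = A \<Longrightarrow> Id C A \<cdot> f = f"
  by (rule Id_Comp[where A = "Dom C f"]) simp

lemma Comp_assoc_simp [simp]:
  assumes "f \<in> Arr C" "g \<in> Arr C" "h \<in> Arr C" "Cod C f = Dom C g" "Cod C g = Dom C h"
  shows "(h \<cdot> g) \<cdot> f = h \<cdot> (g \<cdot> f)"
  using Comp_assoc[of f "Dom C f" "Dom C g" g "Dom C h" h "Cod C h"] assms by simp

declare Dom_in_Obj [simp] Cod_in_Obj [simp]

text \<open>Composites are normalized to right-nested form, where an equation for
  \<open>g \<cdot> f\<close> no longer matches inside \<open>g \<cdot> (f \<cdot> x)\<close>. This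
  supplies the missing instance; almost every diagram chase below uses it.\<close>

lemma Comp_extend:
  assumes "g \<cdot> f = h" "f \<in> Arr C" "g \<in> Arr C" "Cod C f = Dom C g" "x \<in> Arr C" "Cod C x = Dom C f"
  shows "g \<cdot> (f \<cdot> x) = h \<cdot> x"
  using Comp_assoc_simp[of x f g] assms by simp

lemma monicD:
  "monic C m \<Longrightarrow> u \<in> Hom C X (Dom C m) \<Longrightarrow> v \<in> Hom C X (Dom C m) \<Longrightarrow> m \<cdot> u = m \<cdot> v \<Longrightarrow> u = v"
  unfolding monic_def by (metis Hom_iff Dom_in_Obj)

lemma monicI:
  assumes "m \<in> Arr C"
    and "\<And>X u v. u \<in> Hom C X (Dom C m) \<Longrightarrow> v \<in> Hom C X (Dom C m) \<Longrightarrow> m \<cdot> u = m \<cdot> v \<Longrightarrow> u = v"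
  shows "monic C m"
  unfolding monic_def using assms by blast

lemma jointly_monicD:
  "jointly_monic C r s \<Longrightarrow> u \<in> Hom C X (Dom C r) \<Longrightarrow> v \<in> Hom C X (Dom C r) \<Longrightarrow>
    r \<cdot> u = r \<cdot> v \<Longrightarrow> s \<cdot> u = s \<cdot> v \<Longrightarrow> u = v"
  unfolding jointly_monic_def by (metis Hom_iff Dom_in_Obj)

lemma jointly_monic_span:
  assumes "jointly_monic C r s"
  shows "r \<in> Arr C" "s \<in> Arr C" "Dom C s = Dom C r"
  using assms by (auto simp: jointly_monic_def is_span_def)

lemma jointly_monicI:
  assumes "r \<in> Arr C" "s \<in> Arr C" "Dom C s = Dom C r"
    and "\<And>X u v. u \<in> Hom C X (Dom C r) \<Longrightarrow> v \<in> Hom C X (Dom C r) \<Longrightarrow>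
      r \<cdot> u = r \<cdot> v \<Longrightarrow> s \<cdot> u = s \<cdot> v \<Longrightarrow> u = v"
  shows "jointly_monic C r s"
  unfolding jointly_monic_def is_span_def using assms by metis

section \<open>Pullbacks, pushouts, coequalizers and coproducts\<close>

lemma is_pullback_comm:
  assumes "is_pullback C p q h k"
  shows "p \<in> Arr C" "q \<in> Arr C" "h \<in> Arr C" "k \<in> Arr C"
    "Dom C q = Dom C p" "Cod C p = Dom C h" "Cod C q = Dom C k" "Cod C k = Cod C h"
    "h \<cdot> p = k \<cdot> q"
  using assms by (auto simp: comm_square_def is_pullback_def)

lemma is_pullback_lift:
  assumes "is_pullback C p q h k" "u \<in> Hom C X (Dom C h)" "v \<in> Hom C X (Dom C k)" "h \<cdot> u = k \<cdot> v"
  obtains w where "w \<in> Arr C" "Dom C w = X" "Cod C w = Dom C p" "p \<cdot> w = u" "q \<cdot> w = v"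
proof -
  have "comm_square C u v h k"
    using assms is_pullback_comm[OF assms(1)] by (simp add: comm_square_def)
  then show ?thesis using assms(1,2) that unfolding is_pullback_def by (metis Hom_iff)
qed

lemma is_pullback_eqI:
  assumes "is_pullback C p q h k" "w \<in> Hom C X (Dom C p)" "w' \<in> Hom C X (Dom C p)"
    "p \<cdot> w = p \<cdot> w'" "q \<cdot> w = q \<cdot> w'"
  shows "w = w'"
proof -
  note [simp] = is_pullback_comm[OF assms(1)]
  have "comm_square C (p \<cdot> w) (q \<cdot> w) h k"
    using assms(2) Comp_extend[OF is_pullback_comm(9)[OF assms(1)], of w]
    by (simp add: comm_square_def)
  moreover have "Dom C (p \<cdot> w) = X" using assms(2) by simp
  ultimately show ?thesis using assms unfolding is_pullback_def by metis
qed

lemma is_pullbackI: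
  assumes "comm_square C p q h k"
    and "\<And>X u v. u \<in> Hom C X (Dom C h) \<Longrightarrow> v \<in> Hom C X (Dom C k) \<Longrightarrow> h \<cdot> u = k \<cdot> v \<Longrightarrow>
      \<exists>w \<in> Hom C X (Dom C p). p \<cdot> w = u \<and> q \<cdot> w = v"
    and "\<And>X w w'. w \<in> Hom C X (Dom C p) \<Longrightarrow> w' \<in> Hom C X (Dom C p) \<Longrightarrow>
      p \<cdot> w = p \<cdot> w' \<Longrightarrow> q \<cdot> w = q \<cdot> w' \<Longrightarrow> w = w'"
  shows "is_pullback C p q h k"
  unfolding is_pullback_def
proof (intro conjI allI impI)
  fix u v assume uv: "comm_square C u v h k"
  then have "u \<in> Hom C (Dom C u) (Dom C h)" "v \<in> Hom C (Dom C u) (Dom C k)" "h \<cdot> u = k \<cdot> v"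
    by (auto simp: comm_square_def)
  from assms(2)[OF this] show "\<exists>!w. w \<in> Hom C (Dom C u) (Dom C p) \<and> p \<cdot> w = u \<and> q \<cdot> w = v"
    using assms(3) by (metis (no_types, lifting))
qed (fact assms(1))

lemma is_pullback_jointly_monic: "is_pullback C p q h k \<Longrightarrow> jointly_monic C p q"
  by (rule jointly_monicI) (simp_all only: is_pullback_comm, rule is_pullback_eqI)

lemma is_pushoutI:
  assumes "comm_square C f g h k"
    and "\<And>T u v. u \<in> Hom C (Cod C f) T \<Longrightarrow> v \<in> Hom C (Cod C g) T \<Longrightarrow> u \<cdot> f = v \<cdot> g \<Longrightarrow>
      \<exists>w \<in> Hom C (Cod C h) T. w \<cdot> h = u \<and> w \<cdot> k = v"
    and "\<And>T w w'. w \<in> Hom C (Cod C h) T \<Longrightarrow> w' \<in> Hom C (Cod C h) T \<Longrightarrow>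
      w \<cdot> h = w' \<cdot> h \<Longrightarrow> w \<cdot> k = w' \<cdot> k \<Longrightarrow> w = w'"
  shows "is_pushout C f g h k"
  unfolding is_pushout_def
proof (intro conjI allI impI)
  fix u v assume uv: "comm_square C f g u v"
  then have "u \<in> Hom C (Cod C f) (Cod C u)" "v \<in> Hom C (Cod C g) (Cod C u)" "u \<cdot> f = v \<cdot> g"
    by (auto simp: comm_square_def)
  from assms(2)[OF this] show "\<exists>!w. w \<in> Hom C (Cod C h) (Cod C u) \<and> w \<cdot> h = u \<and> w \<cdot> k = v"
    using assms(3) by (metis (no_types, lifting))
qed (fact assms(1))

lemma is_pushout_comm:
  assumes "is_pushout C f g h k"
  shows "f \<in> Arr C" "g \<in> Arr C" "h \<in> Arr C" "k \<in> Arr C"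
    "Dom C g = Dom C f" "Dom C h = Cod C f" "Dom C k = Cod C g" "Cod C k = Cod C h"
    "h \<cdot> f = k \<cdot> g"
  using assms by (auto simp: comm_square_def is_pushout_def)

lemma is_pushout_lift:
  assumes "is_pushout C f g h k" "u \<in> Hom C (Cod C f) T" "v \<in> Hom C (Cod C g) T" "u \<cdot> f = v \<cdot> g"
  obtains w where "w \<in> Arr C" "Dom C w = Cod C h" "Cod C w = T" "w \<cdot> h = u" "w \<cdot> k = v"
proof -
  have "comm_square C f g u v"
    using assms is_pushout_comm[OF assms(1)] by (simp add: comm_square_def)
  then show ?thesis using assms(1,2) that unfolding is_pushout_def by (metis Hom_iff)
qed

lemma is_pushout_eqI:
  assumes "is_pushout C f g h k" "w \<in> Hom C (Cod C h) T" "w' \<in> Hom C (Cod C h) T"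
    "w \<cdot> h = w' \<cdot> h" "w \<cdot> k = w' \<cdot> k"
  shows "w = w'"
proof -
  note [simp] = is_pushout_comm[OF assms(1)]
  have "comm_square C f g (w \<cdot> h) (w \<cdot> k)"
    using assms(2) by (simp add: comm_square_def)
  moreover have "Cod C (w \<cdot> h) = T" using assms(2) by simp
  ultimately show ?thesis using assms unfolding is_pushout_def by metis
qed

lemma is_coequalizerD:
  assumes "is_coequalizer C r s e"
  shows "r \<in> Arr C" "s \<in> Arr C" "e \<in> Arr C" "Dom C s = Dom C r" "Cod C s = Cod C r"
    "Dom C e = Cod C r" "e \<cdot> r = e \<cdot> s"
  using assms by (auto simp: is_coequalizer_def)

lemma is_coequalizer_lift:
  assumes "is_coequalizer C r s e" "t \<in> Hom C (Cod C r) T" "t \<cdot> r = t \<cdot> s"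
  obtains w where "w \<in> Arr C" "Dom C w = Cod C e" "Cod C w = T" "w \<cdot> e = t"
  using assms unfolding is_coequalizer_def by (metis Hom_iff)

lemma is_coequalizer_epi:
  assumes "is_coequalizer C r s e" "w \<in> Hom C (Cod C e) T" "w' \<in> Hom C (Cod C e) T" "w \<cdot> e = w' \<cdot> e"
  shows "w = w'"
proof -
  note [simp] = is_coequalizerD[OF assms(1)]
  have "w \<cdot> e \<in> Arr C \<and> Dom C (w \<cdot> e) = Cod C r \<and> (w \<cdot> e) \<cdot> r = (w \<cdot> e) \<cdot> s \<and> Cod C (w \<cdot> e) = T"
    using assms(2) by simp
  then show ?thesis using assms unfolding is_coequalizer_def by metis
qed

lemma is_coequalizerI:
  assumes "r \<in> Arr C" "s \<in> Arr C" "e \<in> Arr C" "Dom C s = Dom C r" "Cod C s = Cod C r"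
    "Dom C e = Cod C r" "e \<cdot> r = e \<cdot> s"
    and "\<And>T t. t \<in> Hom C (Cod C r) T \<Longrightarrow> t \<cdot> r = t \<cdot> s \<Longrightarrow> \<exists>w \<in> Hom C (Cod C e) T. w \<cdot> e = t"
    and "\<And>T w w'. w \<in> Hom C (Cod C e) T \<Longrightarrow> w' \<in> Hom C (Cod C e) T \<Longrightarrow> w \<cdot> e = w' \<cdot> e \<Longrightarrow> w = w'"
  shows "is_coequalizer C r s e"
  unfolding is_coequalizer_def
proof (intro conjI ballI impI)
  fix t assume "t \<in> Arr C" "Dom C t = Cod C r \<and> t \<cdot> r = t \<cdot> s"
  then have "\<exists>w \<in> Hom C (Cod C e) (Cod C t). w \<cdot> e = t" by (intro assms(8)) simp_all
  then show "\<exists>!w. w \<in> Hom C (Cod C e) (Cod C t) \<and> w \<cdot> e = t"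
    using assms(9) by (metis (no_types, lifting))
qed (use assms in simp_all)

lemma regular_epi_Arr: "regular_epi C e \<Longrightarrow> e \<in> Arr C"
  by (auto simp: regular_epi_def is_coequalizer_def)

lemma regular_epi_epi:
  "regular_epi C e \<Longrightarrow> w \<in> Hom C (Cod C e) T \<Longrightarrow> w' \<in> Hom C (Cod C e) T \<Longrightarrow> w \<cdot> e = w' \<cdot> e \<Longrightarrow> w = w'"
  unfolding regular_epi_def by (metis is_coequalizer_epi)

lemma is_coproductD:
  assumes "is_coproduct C I X S inc"
  shows "S \<in> Obj C" "i \<in> I \<Longrightarrow> X i \<in> Obj C"
    "i \<in> I \<Longrightarrow> inc i \<in> Arr C" "i \<in> I \<Longrightarrow> Dom C (inc i) = X i" "i \<in> I \<Longrightarrow> Cod C (inc i) = S"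
  using assms by (auto simp: is_coproduct_def)

lemma is_coproduct_lift:
  assumes "is_coproduct C I X S inc" "T \<in> Obj C" "\<And>i. i \<in> I \<Longrightarrow> t i \<in> Hom C (X i) T"
  obtains w where "w \<in> Arr C" "Dom C w = S" "Cod C w = T" "\<And>i. i \<in> I \<Longrightarrow> w \<cdot> inc i = t i"
proof -
  have "\<exists>!w. w \<in> Hom C S T \<and> (\<forall>i\<in>I. w \<cdot> inc i = t i)"
    using assms unfolding is_coproduct_def by blast
  then show ?thesis using that by auto
qed

lemma is_coproduct_eqI:
  assumes c: "is_coproduct C I X S inc" and w: "w \<in> Hom C S T" "w' \<in> Hom C S T"
    and eq: "\<And>i. i \<in> I \<Longrightarrow> w \<cdot> inc i = w' \<cdot> inc i"
  shows "w = w'"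
proof -
  have T: "T \<in> Obj C" using w(1) Cod_in_Obj[of w] by simp
  have wi: "w \<cdot> inc i \<in> Hom C (X i) T" if i: "i \<in> I" for i
    using w(1) is_coproductD(3-5)[OF c i] by simp
  define t where "t i = w \<cdot> inc i" for i
  have "\<exists>!v. v \<in> Hom C S T \<and> (\<forall>i\<in>I. v \<cdot> inc i = t i)"
    using c[unfolded is_coproduct_def, THEN conjunct2, THEN conjunct2, THEN spec, THEN spec] T wi t_def
    by (metis (no_types, lifting))
  then show ?thesis using w eq t_def by (metis (no_types, lifting))
qed

lemma is_coproductI:
  assumes "S \<in> Obj C" "\<And>i. i \<in> I \<Longrightarrow> X i \<in> Obj C" "\<And>i. i \<in> I \<Longrightarrow> inc i \<in> Hom C (X i) S"
    and "\<And>T t. T \<in> Obj C \<Longrightarrow> (\<And>i. i \<in> I \<Longrightarrow> t i \<in> Hom C (X i) T) \<Longrightarrow>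
      \<exists>w \<in> Hom C S T. \<forall>i \<in> I. w \<cdot> inc i = t i"
    and "\<And>T w w'. w \<in> Hom C S T \<Longrightarrow> w' \<in> Hom C S T \<Longrightarrow>
      (\<And>i. i \<in> I \<Longrightarrow> w \<cdot> inc i = w' \<cdot> inc i) \<Longrightarrow> w = w'"
  shows "is_coproduct C I X S inc"
  unfolding is_coproduct_def
proof (intro conjI allI impI)
  fix T t assume t: "T \<in> Obj C \<and> (\<forall>i\<in>I. t i \<in> Hom C (X i) T)"
  then have "\<exists>w \<in> Hom C S T. \<forall>i \<in> I. w \<cdot> inc i = t i" using assms(4) by blast
  then show "\<exists>!w. w \<in> Hom C S T \<and> (\<forall>i\<in>I. w \<cdot> inc i = t i)"
    using assms(5) by (metis (no_types, lifting))
qed (use assms in auto)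

text \<open>Makes initial objects subject to the existence and stability of finite coproducts, and
  gives the base case of inductions on the index set.\<close>

lemma is_initial_empty_coproduct: "is_coproduct C {} X Z inc \<longleftrightarrow> is_initial C Z"
  by (auto simp: is_coproduct_def is_initial_def)

lemma is_initial_lift:
  assumes "is_initial C Z" "X \<in> Obj C"
  obtains w where "w \<in> Arr C" "Dom C w = Z" "Cod C w = X"
  using assms unfolding is_initial_def by auto

lemma is_initial_eqI:
  "is_initial C Z \<Longrightarrow> u \<in> Hom C Z X \<Longrightarrow> v \<in> Hom C Z X \<Longrightarrow> u = v"
  unfolding is_initial_def by (metis Hom_iff Cod_in_Obj)

text \<open>A retract of an initial object is initial: an arrow \<open>a\<close> out of
  \<open>Y\<close> equals \<open>(a \<cdot> u) \<cdot> v\<close>, and \<open>a \<cdot> u\<close>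
  starts at \<open>Z\<close>.\<close>

lemma is_initial_iso:
  assumes "is_initial C Z" "u \<in> Hom C Z Y" "v \<in> Hom C Y Z" "u \<cdot> v = Id C Y"
  shows "is_initial C Y"
  unfolding is_initial_def
proof (intro conjI ballI)
  fix X assume "X \<in> Obj C"
  then obtain w where w: "w \<in> Arr C" "Dom C w = Z" "Cod C w = X"
    using assms(1) is_initial_lift by blast
  have "a = w \<cdot> v" if "a \<in> Hom C Y X" for a
  proof -
    have "a \<cdot> u = w" using that assms w by (intro is_initial_eqI[of Z]) auto
    then have "a \<cdot> (u \<cdot> v) = w \<cdot> v" using that assms by (subst Comp_extend) auto
    then show ?thesis using that assms by simp
  qed
  then show "\<exists>!w. w \<in> Hom C Y X" using assms w by (intro ex1I[of _ "w \<cdot> v"]) auto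
qed (use assms in auto)

lemma is_initial_domI:
  assumes "is_strict_initial C Z" "f \<in> Arr C" "Cod C f = Z"
  shows "is_initial C (Dom C f)"
proof -
  obtain g where "g \<in> Hom C Z (Dom C f)" "g \<cdot> f = Id C (Dom C f)"
    using assms unfolding is_strict_initial_def invertible_def by blast
  then show ?thesis using assms is_initial_iso[of Z g "Dom C f" f]
    by (simp add: is_strict_initial_def)
qed

section \<open>Finite limits\<close>

lemma terminal_exists:
  assumes "finitely_complete C"
  obtains T where "T \<in> Obj C" "\<And>X. X \<in> Obj C \<Longrightarrow> \<exists>w. w \<in> Hom C X T"
    "\<And>X u v. u \<in> Hom C X T \<Longrightarrow> v \<in> Hom C X T \<Longrightarrow> u = v"
proof -
  define J :: "(nat, nat) cat" where "J = \<lparr>Obj = {}, Arr = {}, Dom = id, Cod = id, Id = id, Comp = (\<lambda>x y. x)\<rparr>"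
  have "category J" by unfold_locales (auto simp: J_def Hom_def)
  \<comment> \<open>The shape is empty, so the functor is never evaluated.\<close>
  moreover have "is_functor J C undefined undefined" by (simp add: is_functor_def J_def)
  moreover have "finite (Obj J)" "finite (Arr J)" by (simp_all add: J_def)
  ultimately obtain L p where "is_limit J C undefined undefined L p"
    using assms unfolding finitely_complete_def by blast
  then have L: "L \<in> Obj C" "\<And>X. X \<in> Obj C \<Longrightarrow> \<exists>!w. w \<in> Hom C X L"
    by (auto simp: is_limit_def is_cone_def J_def)
  then show ?thesis using that[of L] by (metis Hom_iff Dom_in_Obj)
qed

text \<open>Shape: the objects are \<open>0, 1, 2\<close>, with the same numbers for their identities, and
  \<open>3 : 0 \<rightarrow> 2\<close>, \<open>4 : 1 \<rightarrow> 2\<close>.\<close>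

lemma pullback_exists:
  assumes "finitely_complete C" and [simp]: "h \<in> Arr C" "k \<in> Arr C" "Cod C k = Cod C h"
  obtains p q where "is_pullback C p q h k"
proof -
  \<comment> \<open>An arrow below 3 is an identity. In a composable pair at least one arrow is an
    identity, so the composite is the first arrow if the second is an identity, and the second
    otherwise.\<close>
  define J :: "(nat, nat) cat" where "J = \<lparr>Obj = {0,1,2}, Arr = {0,1,2,3,4},
    Dom = (\<lambda>u. if u = 3 then 0 else if u = 4 then 1 else u), Cod = (\<lambda>u. if u < 3 then u else 2),
    Id = id, Comp = (\<lambda>v u. if v < 3 then u else v)\<rparr>"
  define Fo where "Fo = (\<lambda>i::nat. if i = 0 then Dom C h else if i = 1 then Dom C k else Cod C h)"
  define Fa where "Fa = (\<lambda>u::nat. if u = 3 then h else if u = 4 then k else Id C (Fo u))"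
  have "category J" by unfold_locales (auto simp: J_def Hom_def split: if_splits)
  moreover have "is_functor J C Fo Fa"
    unfolding is_functor_def J_def Fa_def Fo_def by simp
  moreover have "finite (Obj J)" "finite (Arr J)" by (simp_all add: J_def)
  ultimately obtain L t where lim: "is_limit J C Fo Fa L t"
    using assms(1) unfolding finitely_complete_def by blast
  have cone: "is_cone J C Fo Fa X s \<longleftrightarrow> X \<in> Obj C \<and> s 0 \<in> Hom C X (Dom C h) \<and>
    s 1 \<in> Hom C X (Dom C k) \<and> h \<cdot> s 0 = k \<cdot> s 1 \<and> s 2 = h \<cdot> s 0" for X s
    by (auto simp: is_cone_def J_def Fo_def Fa_def)
  have L: "L \<in> Obj C" "t 0 \<in> Hom C L (Dom C h)" "t 1 \<in> Hom C L (Dom C k)" "h \<cdot> t 0 = k \<cdot> t 1"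
    "t 2 = h \<cdot> t 0"
    using lim unfolding is_limit_def cone by auto
  have univ: "\<exists>!w. w \<in> Hom C X L \<and> t 0 \<cdot> w = u \<and> t 1 \<cdot> w = v"
    if "u \<in> Hom C X (Dom C h)" "v \<in> Hom C X (Dom C k)" "h \<cdot> u = k \<cdot> v" for X u v
  proof -
    define s where "s = (\<lambda>i::nat. if i = 0 then u else if i = 1 then v else h \<cdot> u)"
    have "is_cone J C Fo Fa X s" unfolding cone s_def using that by auto
    then have "\<exists>!w. w \<in> Hom C X L \<and> (\<forall>i\<in>Obj J. t i \<cdot> w = s i)"
      using lim unfolding is_limit_def by blast
    moreover have "(w \<in> Hom C X L \<and> (\<forall>i\<in>Obj J. t i \<cdot> w = s i)) \<longleftrightarrow>
      (w \<in> Hom C X L \<and> t 0 \<cdot> w = u \<and> t 1 \<cdot> w = v)" for w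
      using L Comp_extend[OF L(4), of w] by (auto simp: J_def s_def)
    ultimately show ?thesis by simp
  qed
  have "is_pullback C (t 0) (t 1) h k"
    unfolding is_pullback_def
  proof (intro conjI allI impI)
    fix u v assume "comm_square C u v h k"
    then show "\<exists>!w. w \<in> Hom C (Dom C u) (Dom C (t 0)) \<and> t 0 \<cdot> w = u \<and> t 1 \<cdot> w = v"
      using univ[of u "Dom C u" v] L by (simp add: comm_square_def)
  qed (use L in \<open>simp add: comm_square_def\<close>)
  then show ?thesis using that by blast
qed

text \<open>A product is a pullback over a terminal object, where every square commutes.\<close>

lemma product_exists:
  assumes "finitely_complete C" "A \<in> Obj C" "B \<in> Obj C"
  obtains p q where "p \<in> Arr C" "q \<in> Arr C" "Dom C q = Dom C p" "Cod C p = A" "Cod C q = B"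
    "\<And>X u v. u \<in> Hom C X A \<Longrightarrow> v \<in> Hom C X B \<Longrightarrow> \<exists>w \<in> Hom C X (Dom C p). p \<cdot> w = u \<and> q \<cdot> w = v"
    "jointly_monic C p q"
proof -
  obtain T where T: "\<And>X. X \<in> Obj C \<Longrightarrow> \<exists>w. w \<in> Hom C X T"
    "\<And>X u v. u \<in> Hom C X T \<Longrightarrow> v \<in> Hom C X T \<Longrightarrow> u = v"
    using terminal_exists[OF assms(1)] by metis
  obtain a b where ab: "a \<in> Hom C A T" "b \<in> Hom C B T" using T(1) assms by metis
  then obtain p q where pb: "is_pullback C p q a b"
    using pullback_exists[OF assms(1), of a b] by auto
  note pq = is_pullback_comm[OF pb]
  show ?thesis
  proof (rule that[of p q])
    fix X u v assume uv: "u \<in> Hom C X A" "v \<in> Hom C X B"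
    then have "a \<cdot> u = b \<cdot> v" using ab by (intro T(2)[of _ X]) auto
    then show "\<exists>w \<in> Hom C X (Dom C p). p \<cdot> w = u \<and> q \<cdot> w = v"
      using is_pullback_lift[OF pb, of u X v] uv ab by (metis Hom_iff)
  qed (use pq ab is_pullback_jointly_monic[OF pb] in auto)
qed

text \<open>Two successive pullbacks: pairs with equal \<open>g\<close>, then a third element whose
  \<open>f\<close> matches that of the second.\<close>

lemma zigzag_limit_exists:
  assumes fc: "finitely_complete C" and span: "is_span C f g"
  obtains P p1 p2 p3 where "zigzag_limit C f g P p1 p2 p3"
proof -
  have [simp]: "f \<in> Arr C" "g \<in> Arr C" "Dom C g = Dom C f" using span by (auto simp: is_span_def)
  obtain a b where ab: "is_pullback C a b g g" using pullback_exists[OF fc, of g g] by auto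
  note [simp] = is_pullback_comm(1-8)[OF ab]
  obtain c d where cd: "is_pullback C c d (f \<cdot> b) f" using pullback_exists[OF fc, of "f \<cdot> b" f] by auto
  note [simp] = is_pullback_comm(1,2,4-8)[OF cd]
  have e1: "g \<cdot> a = g \<cdot> b" using is_pullback_comm(9)[OF ab] .
  have e2: "f \<cdot> (b \<cdot> c) = f \<cdot> d" using is_pullback_comm(9)[OF cd] by simp
  have "zigzag_limit C f g (Dom C c) (a \<cdot> c) (b \<cdot> c) d"
    unfolding zigzag_limit_def
  proof (intro conjI allI impI)
    show "zigzag C f g (Dom C c) (a \<cdot> c) (b \<cdot> c) d"
      using e2 by (simp add: zigzag_def Comp_extend[OF e1])
    fix X c1 c2 c3 assume zz: "zigzag C f g X c1 c2 c3"
    then have [simp]: "c1 \<in> Arr C" "c2 \<in> Arr C" "c3 \<in> Arr C" "Dom C c1 = X" "Dom C c2 = X" "Dom C c3 = X"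
      "Cod C c1 = Dom C f" "Cod C c2 = Dom C f" "Cod C c3 = Dom C f" "g \<cdot> c1 = g \<cdot> c2" "f \<cdot> c2 = f \<cdot> c3"
      by (auto simp: zigzag_def)
    obtain v where v [simp]: "v \<in> Arr C" "Dom C v = X" "Cod C v = Dom C a" "a \<cdot> v = c1" "b \<cdot> v = c2"
      using is_pullback_lift[OF ab, of c1 X c2] by auto
    obtain w where w [simp]: "w \<in> Arr C" "Dom C w = X" "Cod C w = Dom C c" "c \<cdot> w = v" "d \<cdot> w = c3"
      using is_pullback_lift[OF cd, of v X c3] by auto
    show "\<exists>!w. w \<in> Hom C X (Dom C c) \<and> (a \<cdot> c) \<cdot> w = c1 \<and> (b \<cdot> c) \<cdot> w = c2 \<and> d \<cdot> w = c3"
    proof (rule ex1I[of _ w])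
      fix w' assume w': "w' \<in> Hom C X (Dom C c) \<and> (a \<cdot> c) \<cdot> w' = c1 \<and> (b \<cdot> c) \<cdot> w' = c2 \<and> d \<cdot> w' = c3"
      have "c \<cdot> w' = v" by (rule is_pullback_eqI[OF ab, of _ X]) (use w' in auto)
      then show "w' = w" by (intro is_pullback_eqI[OF cd, of w' X w]) (use w' in auto)
    qed simp
  qed
  then show ?thesis using that by blast
qed

text \<open>Turns the Mal'cev operation into a condition on generalized elements: applied to the
  universal zigzag of projections, the condition yields \<open>m\<close>. Conversely,
  \<open>malcev_spanE\<close> composes \<open>m\<close> with the arrow classifying a given
  zigzag.\<close>

lemma malcev_spanI:
  assumes "finitely_complete C" "jointly_monic C f g"
    and "\<And>X c1 c2 c3. zigzag C f g X c1 c2 c3 \<Longrightarrow> \<exists>c \<in> Hom C X (Dom C f). f \<cdot> c = f \<cdot> c1 \<and> g \<cdot> c = g \<cdot> c3"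
  shows "malcev_span C f g"
proof -
  obtain P p1 p2 p3 where "zigzag_limit C f g P p1 p2 p3"
    using zigzag_limit_exists[OF assms(1)] assms(2) unfolding jointly_monic_def by metis
  moreover from this obtain m where "m \<in> Hom C P (Dom C f)" "f \<cdot> m = f \<cdot> p1" "g \<cdot> m = g \<cdot> p3"
    using assms(3) unfolding zigzag_limit_def by blast
  ultimately show ?thesis using assms(2) unfolding malcev_span_def by blast
qed

lemma malcev_spanE:
  assumes "malcev_span C f g" "zigzag C f g X c1 c2 c3"
  obtains c where "c \<in> Arr C" "Dom C c = X" "Cod C c = Dom C f" "f \<cdot> c = f \<cdot> c1" "g \<cdot> c = g \<cdot> c3"
proof -
  obtain P p1 p2 p3 m where zl: "zigzag_limit C f g P p1 p2 p3"
    and m: "m \<in> Hom C P (Dom C f)" "f \<cdot> m = f \<cdot> p1" "g \<cdot> m = g \<cdot> p3"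
    using assms(1) unfolding malcev_span_def by blast
  have [simp]: "f \<in> Arr C" "g \<in> Arr C" "Dom C g = Dom C f"
    using assms(1) unfolding malcev_span_def by (auto dest: jointly_monic_span)
  have p: "p1 \<in> Hom C P (Dom C f)" "p3 \<in> Hom C P (Dom C f)"
    using zl unfolding zigzag_limit_def zigzag_def by auto
  obtain w where w: "w \<in> Hom C X P" "p1 \<cdot> w = c1" "p3 \<cdot> w = c3"
    using zl assms(2) unfolding zigzag_limit_def by blast
  show ?thesis using that[of "m \<cdot> w"] w m p Comp_extend[OF m(2), of w] Comp_extend[OF m(3), of w] by simp
qed


section \<open>Diexact categories with a strict initial object\<close>

lemma is_initial_dom_of_initial:
  assumes st: "is_strict_initial C Z" and f: "f \<in> Arr C" and "is_initial C (Cod C f)"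
  shows "is_initial C (Dom C f)"
proof -
  obtain w where "w \<in> Arr C" "Dom C w = Cod C f" "Cod C w = Z"
    using assms is_initial_lift[of "Cod C f" Z] by (auto simp: is_strict_initial_def is_initial_def)
  then show ?thesis using is_initial_domI[OF st, of "w \<cdot> f"] f by simp
qed

text \<open>\<open>stable_pushout\<close> quantifies over all four pulled back corners and the
  induced arrows. Usually only the pullbacks of the two legs are at hand; the remaining corner and
  the arrows out of it are produced here.\<close>

lemma stable_pushout_pullback:
  assumes fc: "finitely_complete C" and stable: "stable_pushout C f g h k"
    and pb: "is_pullback C a h' h x" "is_pullback C b k' k x"
  obtains c l f' g' where "is_pullback C c l (h \<cdot> f) x" "is_pushout C f' g' h' k'" "Dom C f' = Dom C c"
proof -
  have po: "is_pushout C f g h k" using stable by (simp add: stable_pushout_def)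
  note [simp] = is_pushout_comm(1-8)[OF po]
  note [simp] = is_pullback_comm(1,2,4-8)[OF pb(1)]
  note [simp] = is_pullback_comm(1,2,5-7)[OF pb(2)]
  obtain c l where cl: "is_pullback C c l (h \<cdot> f) x"
    using pullback_exists[OF fc, of "h \<cdot> f" x] by auto
  have eq: "h \<cdot> (f \<cdot> c) = x \<cdot> l" using is_pullback_comm[OF cl] by simp
  have eq': "k \<cdot> (g \<cdot> c) = x \<cdot> l"
    using eq Comp_extend[OF is_pushout_comm(9)[OF po], of c] is_pullback_comm[OF cl] by simp
  note [simp] = is_pullback_comm(1,2,5-7)[OF cl]
  obtain f' where f': "f' \<in> Hom C (Dom C c) (Dom C a)" "a \<cdot> f' = f \<cdot> c" "h' \<cdot> f' = l"
    using is_pullback_lift[OF pb(1), of "f \<cdot> c" "Dom C c" l] eq by auto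
  obtain g' where g': "g' \<in> Hom C (Dom C c) (Dom C b)" "b \<cdot> g' = g \<cdot> c" "k' \<cdot> g' = l"
    using is_pullback_lift[OF pb(2), of "g \<cdot> c" "Dom C c" l] eq' by auto
  have "is_pushout C f' g' h' k'"
    using stable pb cl f' g' unfolding stable_pushout_def by blast
  then show ?thesis using that[OF cl] f' by simp
qed

text \<open>One half of the pasting law: outer rectangle and right square determine the left
  square.\<close>

lemma is_pullback_left:
  assumes outer: "is_pullback C p q (h \<cdot> i) x" and right: "is_pullback C a b h x"
    and i [simp]: "i \<in> Arr C" "Cod C i = Dom C h"
    and r [simp]: "r \<in> Arr C" "Dom C r = Dom C p" "Cod C r = Dom C a"
    and eq: "a \<cdot> r = i \<cdot> p" "b \<cdot> r = q"
  shows "is_pullback C p r i a"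
proof (rule is_pullbackI)
  note [simp] = is_pullback_comm(1-8)[OF right]
  note [simp] = is_pullback_comm(1,2,5-7)[OF outer]
  show "comm_square C p r i a" using eq by (simp add: comm_square_def)
  fix X
  { fix u v assume "u \<in> Hom C X (Dom C i)" "v \<in> Hom C X (Dom C a)" and iu: "i \<cdot> u = a \<cdot> v"
    then have [simp]: "u \<in> Arr C" "v \<in> Arr C" "Dom C u = X" "Dom C v = X" "Cod C u = Dom C i"
      "Cod C v = Dom C a" by simp_all
    have "(h \<cdot> i) \<cdot> u = x \<cdot> (b \<cdot> v)"
      using Comp_extend[OF is_pullback_comm(9)[OF right], of v] iu by simp
    then obtain w where w: "w \<in> Arr C" "Dom C w = X" "Cod C w = Dom C p" "p \<cdot> w = u" "q \<cdot> w = b \<cdot> v"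
      by (rule is_pullback_lift[OF outer, of u X "b \<cdot> v", rotated 2]) simp_all
    have "r \<cdot> w = v"
      by (rule is_pullback_eqI[OF right, of _ X])
        (use w iu Comp_extend[OF eq(1), of w] Comp_extend[OF eq(2), of w] in simp_all)
    then show "\<exists>w\<in>Hom C X (Dom C p). p \<cdot> w = u \<and> r \<cdot> w = v" using w by auto }
  { fix w w' assume w: "w \<in> Hom C X (Dom C p)" "w' \<in> Hom C X (Dom C p)" "p \<cdot> w = p \<cdot> w'" "r \<cdot> w = r \<cdot> w'"
    have "q \<cdot> w = q \<cdot> w'" using w Comp_extend[OF eq(2), of w] Comp_extend[OF eq(2), of w'] by simp
    then show "w = w'" using w by (intro is_pullback_eqI[OF outer, of w X w']) auto }
qed

text \<open>A pushout over an initial object is a binary coproduct, since its commutativity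
  condition is automatic. Attaching one summand in this way is the step of the inductions over
  finite index sets.\<close>

lemma is_coproduct_insert:
  assumes po: "is_pushout C a b (inc i) j" and init: "is_initial C (Dom C a)"
    and cop: "is_coproduct C I X T inc'" and Xi: "X i = Cod C a" and T: "T = Cod C b"
    and inc: "\<And>n. n \<in> I \<Longrightarrow> inc n = j \<cdot> inc' n"
  shows "is_coproduct C (insert i I) X (Cod C j) inc"
proof (rule is_coproductI)
  note [simp] = is_pushout_comm(1-8)[OF po]
  note cD = is_coproductD[OF cop]
  have j: "j \<in> Arr C" "Dom C j = T" "Cod C (inc i) = Cod C j" using T by simp_all
  show "Cod C j \<in> Obj C" by simp
  show "X n \<in> Obj C" if "n \<in> insert i I" for n using that cD(2) Xi by auto
  show "inc n \<in> Hom C (X n) (Cod C j)" if "n \<in> insert i I" for n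
    using that inc[of n] cD(3-5)[of n] j Xi by (cases "n = i") auto
  { fix S t assume S: "S \<in> Obj C" and t: "\<And>n. n \<in> insert i I \<Longrightarrow> t n \<in> Hom C (X n) S"
    obtain v where v: "v \<in> Arr C" "Dom C v = T" "Cod C v = S" "\<And>n. n \<in> I \<Longrightarrow> v \<cdot> inc' n = t n"
      using is_coproduct_lift[OF cop S, of t] t by auto
    have "t i \<cdot> a = v \<cdot> b"
      by (rule is_initial_eqI[OF init, of _ S]) (use t[of i] v Xi T in simp_all)
    then obtain w where w: "w \<in> Arr C" "Dom C w = Cod C j" "Cod C w = S" "w \<cdot> inc i = t i" "w \<cdot> j = v"
      using is_pushout_lift[OF po, of "t i" S v] v T Xi t[of i] by auto
    have "w \<cdot> inc n = t n" if "n \<in> insert i I" for n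
    proof (cases "n \<in> I")
      case True
      then show ?thesis
        using inc[OF True] Comp_extend[OF w(5), of "inc' n"] w cD(3-5)[OF True] T v(4)[OF True] by simp
    qed (use that w in auto)
    then show "\<exists>w\<in>Hom C (Cod C j) S. \<forall>n\<in>insert i I. w \<cdot> inc n = t n"
      using w by (intro bexI[of _ w]) simp_all }
  { fix S w w' assume w: "w \<in> Hom C (Cod C j) S" "w' \<in> Hom C (Cod C j) S"
      and eq: "\<And>n. n \<in> insert i I \<Longrightarrow> w \<cdot> inc n = w' \<cdot> inc n"
    have "w \<cdot> j = w' \<cdot> j"
    proof (rule is_coproduct_eqI[OF cop, of _ S])
      fix n assume n: "n \<in> I"
      show "(w \<cdot> j) \<cdot> inc' n = (w' \<cdot> j) \<cdot> inc' n"
        using eq[of n] n inc[OF n] cD(3-5)[OF n] w T by simp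
    qed (use w T in auto)
    then show "w = w'" using is_pushout_eqI[OF po, of w S w'] w eq[of i] by simp }
qed

text \<open>The reverse passage: splitting one summand off a given coproduct exhibits it as a
  pushout over an initial object, to which diexactness applies.\<close>

lemma is_pushout_coproduct:
  assumes cop: "is_coproduct C (insert i I) X S inc" and "i \<notin> I"
    and cop': "is_coproduct C I X T inc'"
    and ab: "a \<in> Hom C Z (X i)" "b \<in> Hom C Z T" and init: "is_initial C Z"
    and j: "j \<in> Hom C T S" "\<And>n. n \<in> I \<Longrightarrow> j \<cdot> inc' n = inc n"
  shows "is_pushout C a b (inc i) j"
proof (rule is_pushoutI)
  note cD = is_coproductD[OF cop] and cD' = is_coproductD[OF cop']
  have ii [simp]: "inc i \<in> Arr C" "Dom C (inc i) = X i" "Cod C (inc i) = S" using cD(3-5)[of i] by simp_all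
  have [simp]: "a \<in> Arr C" "b \<in> Arr C" "Dom C a = Z" "Dom C b = Z" "Cod C a = X i" "Cod C b = T"
     "j \<in> Arr C" "Dom C j = T" "Cod C j = S"
    using ab j by simp_all
  have "inc i \<cdot> a = j \<cdot> b" by (rule is_initial_eqI[OF init, of _ S]) simp_all
  then show "comm_square C a b (inc i) j" by (simp add: comm_square_def)
  fix T'
  { fix u v assume uv: "u \<in> Hom C (Cod C a) T'" "v \<in> Hom C (Cod C b) T'"
    have "T' \<in> Obj C" using uv Cod_in_Obj[of u] by simp
    moreover have "(if n = i then u else v \<cdot> inc' n) \<in> Hom C (X n) T'" if "n \<in> insert i I" for n
      using that cD'(3-5)[of n] uv by auto
    ultimately obtain w where w: "w \<in> Arr C" "Dom C w = S" "Cod C w = T'"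
      "\<And>n. n \<in> insert i I \<Longrightarrow> w \<cdot> inc n = (if n = i then u else v \<cdot> inc' n)"
      using is_coproduct_lift[OF cop, of T' "\<lambda>n. if n = i then u else v \<cdot> inc' n"] by blast
    have "w \<cdot> j = v"
    proof (rule is_coproduct_eqI[OF cop', of _ T'])
      fix n assume n: "n \<in> I"
      then have "n \<noteq> i" using assms(2) by auto
      then show "(w \<cdot> j) \<cdot> inc' n = v \<cdot> inc' n"
        using n w(1-3) w(4)[of n] j(2)[OF n] cD'(3-5)[OF n] by simp
    qed (use w uv in auto)
    then show "\<exists>w\<in>Hom C (Cod C (inc i)) T'. w \<cdot> inc i = u \<and> w \<cdot> j = v"
      using w by (intro bexI[of _ w]) simp_all }
  { fix w w' assume w: "w \<in> Hom C (Cod C (inc i)) T'" "w' \<in> Hom C (Cod C (inc i)) T'"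
      and eq: "w \<cdot> inc i = w' \<cdot> inc i" "w \<cdot> j = w' \<cdot> j"
    show "w = w'"
    proof (rule is_coproduct_eqI[OF cop, of _ T'])
      fix n assume n: "n \<in> insert i I"
      show "w \<cdot> inc n = w' \<cdot> inc n"
      proof (cases "n \<in> I")
        case True
        then show ?thesis
          using Comp_extend[OF eq(2), of "inc' n"] w j(2)[OF True] cD'(3-5)[OF True] by simp
      qed (use n eq in auto)
    qed (use w in auto) }
qed

context
  fixes Z
  assumes dx: "diexact C" and st: "is_strict_initial C Z"
begin

lemma strict_initial_is_initial: "is_initial C Z"
  using st by (simp add: is_strict_initial_def)

lemma diexact_finitely_complete: "finitely_complete C"
  using dx by (simp add: diexact_def)

text \<open>By strictness, any object with an arrow to \<open>Z\<close> is initial, so parallel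
  arrows into \<open>Z\<close> coincide. Joint monicity and the Mal'cev condition are then
  immediate.\<close>

lemma malcev_span_initial:
  assumes [simp]: "a \<in> Arr C" "Dom C a = Z" "b \<in> Arr C" "Dom C b = Z"
  shows "malcev_span C a b"
proof (rule malcev_spanI[OF diexact_finitely_complete])
  have eq: "u = v" if "u \<in> Hom C X Z" "v \<in> Hom C X Z" for u v X
    using is_initial_domI[OF st, of u] that by (intro is_initial_eqI[of X u Z v]) auto
  show "jointly_monic C a b"
    by (rule jointly_monicI) (use eq in auto)
  fix X c1 c2 c3 assume "zigzag C a b X c1 c2 c3"
  then have "c1 \<in> Hom C X Z" "c3 \<in> Hom C X Z" by (simp_all add: zigzag_def)
  then show "\<exists>c\<in>Hom C X (Dom C a). a \<cdot> c = a \<cdot> c1 \<and> b \<cdot> c = b \<cdot> c3" using eq[of c1 X c3] by auto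
qed

lemma binary_sum_exists:
  assumes "A \<in> Obj C" "B \<in> Obj C"
  obtains a b i j where "a \<in> Hom C Z A" "b \<in> Hom C Z B" "is_pushout C a b i j"
proof -
  obtain a b where ab: "a \<in> Hom C Z A" "b \<in> Hom C Z B"
    using assms is_initial_lift[OF strict_initial_is_initial] by (metis Hom_iff)
  then have "malcev_span C a b" by (intro malcev_span_initial) simp_all
  then show ?thesis using that ab dx unfolding diexact_def by blast
qed

lemma binary_sum_properties:
  assumes po: "is_pushout C a b i j" and Z: "Dom C a = Z"
  shows "stable_pushout C a b i j" "is_pullback C a b i j"
  using malcev_span_initial[of a b] is_pushout_comm[OF po] Z dx po unfolding diexact_def by auto

text \<open>The square is a pullback with vertex \<open>Z\<close>, so a common element of both
  summands gives an arrow \<open>X -> Z\<close>.\<close>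

lemma binary_sum_disjoint:
  assumes po: "is_pushout C a b i j" and Z: "Dom C a = Z"
    and u: "u \<in> Hom C X (Dom C i)" "v \<in> Hom C X (Dom C j)" "i \<cdot> u = j \<cdot> v"
  shows "is_initial C X"
  using is_pullback_lift[OF binary_sum_properties(2)[OF po Z] u] is_initial_domI[OF st] Z by metis

text \<open>Pull the square back along \<open>i\<close> itself. The leg \<open>i\<close> becomes the
  projection \<open>q\<close> of its kernel pair, while the other summand becomes initial by
  disjointness. So \<open>q\<close> is a coproduct injection with initial complement and has a
  retraction \<open>w\<close>. If \<open>i\<close> identifies \<open>u\<close> and \<open>v\<close>,
  the elements \<open>(u, v)\<close> and \<open>(v, v)\<close> of the kernel pair have the same
  image under \<open>q\<close>, hence are equal.\<close>

lemma binary_sum_monic: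
  assumes po: "is_pushout C a b i j" and Z: "Dom C a = Z"
  shows "monic C i"
proof (rule monicI)
  note [simp] = is_pushout_comm(1-8)[OF po]
  show "i \<in> Arr C" by simp
  obtain p q where pq: "is_pullback C p q i i"
    using pullback_exists[OF diexact_finitely_complete, of i i] by auto
  obtain b' k' where bk: "is_pullback C b' k' j i"
    using pullback_exists[OF diexact_finitely_complete, of j i] by auto
  obtain c l f' g' where cl: "is_pullback C c l (i \<cdot> a) i" and po': "is_pushout C f' g' q k'"
    "Dom C f' = Dom C c"
    using stable_pushout_pullback[OF diexact_finitely_complete binary_sum_properties(1)[OF po Z] pq bk]
    by blast
  note pq' [simp] = is_pullback_comm(1,2,5-7)[OF pq]
  have f' [simp]: "f' \<in> Arr C" "Cod C f' = Dom C p" "k' \<in> Arr C" "Cod C k' = Cod C q"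
    "g' \<in> Arr C" "Cod C g' = Dom C k'" "Dom C g' = Dom C c" "Dom C f' = Dom C c"
    using is_pushout_comm[OF po'(1)] po'(2) pq'(3) by metis+
  have B': "is_initial C (Dom C k')"
    by (rule binary_sum_disjoint[OF po Z, of k' _ b']) (use is_pullback_comm[OF bk] in simp_all)
  have c0: "is_initial C (Dom C c)"
    using is_initial_domI[OF st, of c] is_pullback_comm[OF cl] Z by simp
  have "Dom C p \<in> Obj C" by simp
  then obtain e where e: "e \<in> Arr C" "Dom C e = Dom C k'" "Cod C e = Dom C p"
    by (rule is_initial_lift[OF B'])
  have "Id C (Dom C p) \<cdot> f' = e \<cdot> g'"
    by (rule is_initial_eqI[OF c0, of _ "Dom C p"]) (use e in simp_all)
  then obtain w where w: "w \<in> Arr C" "Dom C w = Cod C q" "Cod C w = Dom C p" "w \<cdot> q = Id C (Dom C p)"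
    by (rule is_pushout_lift[OF po'(1), of "Id C (Dom C p)" "Dom C p" e, rotated 2]) (use e in simp_all)
  fix X u v assume u: "u \<in> Hom C X (Dom C i)" and v: "v \<in> Hom C X (Dom C i)" and eq: "i \<cdot> u = i \<cdot> v"
  obtain x where x: "x \<in> Arr C" "Dom C x = X" "Cod C x = Dom C p" "p \<cdot> x = u" "q \<cdot> x = v"
    using is_pullback_lift[OF pq u v eq] by blast
  obtain y where y: "y \<in> Arr C" "Dom C y = X" "Cod C y = Dom C p" "p \<cdot> y = v" "q \<cdot> y = v"
    using is_pullback_lift[OF pq v v] by blast
  have "w \<cdot> (q \<cdot> x) = x" "w \<cdot> (q \<cdot> y) = y"
    using Comp_extend[OF w(4), of x] Comp_extend[OF w(4), of y] w x y by simp_all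
  then show "u = v" using x y by metis
qed

lemma coproduct_exists:
  assumes "finite I" "X ` I \<subseteq> Obj C"
  shows "\<exists>S inc. is_coproduct C I X S inc"
  using assms
proof (induction I)
  case empty
  then show ?case using strict_initial_is_initial is_initial_empty_coproduct by metis
next
  case (insert i I)
  then obtain T inc where cop: "is_coproduct C I X T inc" by auto
  have "X i \<in> Obj C" using insert by simp
  then obtain a b h j where ab: "a \<in> Hom C Z (X i)" "b \<in> Hom C Z T" "is_pushout C a b h j"
    by (rule binary_sum_exists[OF _ is_coproductD(1)[OF cop]])
  have "is_coproduct C (insert i I) X (Cod C j) (\<lambda>n. if n = i then h else j \<cdot> inc n)"
    by (rule is_coproduct_insert[OF _ _ cop, of a b]) (use ab insert strict_initial_is_initial in auto)
  then show ?case by blast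
qed

text \<open>Extensivity concerns every coproduct, not only those built in
  \<open>coproduct_exists\<close>. The given one is therefore compared with a constructed coproduct
  of the remaining summands.\<close>

lemma coproduct_split:
  assumes cop: "is_coproduct C (insert i I) X S inc" and I: "finite I" "i \<notin> I"
  obtains T inc' a b j where "is_coproduct C I X T inc'" "a \<in> Hom C Z (X i)" "b \<in> Hom C Z T"
    "j \<in> Hom C T S" "\<And>n. n \<in> I \<Longrightarrow> j \<cdot> inc' n = inc n" "is_pushout C a b (inc i) j"
proof -
  note cD = is_coproductD[OF cop]
  obtain T inc' where cop': "is_coproduct C I X T inc'"
    using coproduct_exists[OF I(1), of X] cD(2) by blast
  obtain a where a: "a \<in> Hom C Z (X i)" using is_initial_lift[OF strict_initial_is_initial cD(2), of i] by auto
  obtain b where b: "b \<in> Hom C Z T" using is_initial_lift[OF strict_initial_is_initial is_coproductD(1)[OF cop']] by auto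
  obtain j where j: "j \<in> Arr C" "Dom C j = T" "Cod C j = S" "\<And>n. n \<in> I \<Longrightarrow> j \<cdot> inc' n = inc n"
    using is_coproduct_lift[OF cop' cD(1), of inc] cD(3-5) by auto
  then have "is_pushout C a b (inc i) j"
    by (intro is_pushout_coproduct[OF cop I(2) cop' a b strict_initial_is_initial]) auto
  then show ?thesis using that[OF cop' a b, of j] j by simp
qed

lemma coproduct_stable:
  assumes "finite I" "is_coproduct C I X S inc" "x \<in> Arr C" "Cod C x = S"
    "\<And>i. i \<in> I \<Longrightarrow> is_pullback C (p i) (q i) (inc i) x"
  shows "is_coproduct C I (\<lambda>i. Dom C (q i)) (Dom C x) q"
  using assms
proof (induction I arbitrary: S inc x q)
  case empty
  then show ?case using is_initial_empty_coproduct is_initial_dom_of_initial[OF st, of x] by metis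
next
  case (insert i I)
  obtain T inc' a b j where T: "is_coproduct C I X T inc'" "a \<in> Hom C Z (X i)" "b \<in> Hom C Z T"
    "j \<in> Hom C T S" "\<And>n. n \<in> I \<Longrightarrow> j \<cdot> inc' n = inc n" "is_pushout C a b (inc i) j"
    using coproduct_split[OF insert(4) insert(1,2)] by blast
  note cD = is_coproductD[OF T(1)]
  have a: "a \<in> Arr C" "Dom C a = Z" using T by simp_all
  obtain pj qj where pq: "is_pullback C pj qj j x"
    using pullback_exists[OF diexact_finitely_complete, of j x] T insert by auto
  note pqD = is_pullback_comm[OF pq]
  obtain c l f' g' where cl: "is_pullback C c l (inc i \<cdot> a) x" and po': "is_pushout C f' g' (q i) qj"
    "Dom C f' = Dom C c"
    using stable_pushout_pullback[OF diexact_finitely_complete binary_sum_properties(1)[OF T(6) a(2)]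
        insert(7)[of i] pq] by blast
  have "Cod C c = Z" using is_pullback_comm[OF cl] a is_pushout_comm[OF T(6)] by simp
  then have c0: "is_initial C (Dom C f')"
    using is_initial_domI[OF st, of c] is_pullback_comm[OF cl] po'(2) by simp
  \<comment> \<open>The injection \<open>inc n\<close> factors through \<open>j\<close>, so by
    pasting its pullback along \<open>x\<close> is also the pullback of \<open>inc' n\<close> along
    \<open>pj\<close>. The induction hypothesis is then applied with base change along
    \<open>pj\<close>.\<close>
  have "\<exists>r. r \<in> Hom C (Dom C (q n)) (Dom C pj) \<and> qj \<cdot> r = q n \<and> is_pullback C (p n) r (inc' n) pj"
    if n: "n \<in> I" for n
  proof -
    have pb: "is_pullback C (p n) (q n) (inc n) x" using insert(7) n by blast
    note pbD = is_pullback_comm[OF pb]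
    have inc: "inc n = j \<cdot> inc' n" using T(5)[OF n] by simp
    have D: "Dom C (inc n) = Dom C (inc' n)" using T(4) cD(3-5)[OF n] inc by simp
    have "j \<cdot> (inc' n \<cdot> p n) = x \<cdot> q n"
      using pbD D inc T(4) cD(3-5)[OF n] by simp
    then obtain r where r: "r \<in> Arr C" "Dom C r = Dom C (q n)" "Cod C r = Dom C pj"
      "pj \<cdot> r = inc' n \<cdot> p n" "qj \<cdot> r = q n"
      using is_pullback_lift[OF pq, of "inc' n \<cdot> p n" "Dom C (q n)" "q n"] pbD D T(4) cD(3-5)[OF n] by auto
    have "is_pullback C (p n) r (inc' n) pj"
      by (rule is_pullback_left[OF _ pq]) (use pb inc r pbD cD(3-5)[OF n] T(4) in simp_all)
    then show ?thesis using r by auto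
  qed
  then obtain r where r: "\<And>n. n \<in> I \<Longrightarrow> r n \<in> Hom C (Dom C (q n)) (Dom C pj)"
     "\<And>n. n \<in> I \<Longrightarrow> qj \<cdot> r n = q n" "\<And>n. n \<in> I \<Longrightarrow> is_pullback C (p n) (r n) (inc' n) pj"
    by metis
  have "is_coproduct C I (\<lambda>i. Dom C (r i)) (Dom C pj) r"
    by (rule insert.IH[OF T(1)]) (use pqD T(4) r in simp_all)
  then have cop: "is_coproduct C I (\<lambda>i. Dom C (q i)) (Dom C pj) r"
    using r(1) by (simp add: is_coproduct_def)
  have "is_coproduct C (insert i I) (\<lambda>i. Dom C (q i)) (Cod C qj) q"
    by (rule is_coproduct_insert[where inc = q and i = i, OF po'(1) c0 cop])
      (use is_pushout_comm[OF po'(1)] pqD r in simp_all)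
  then show ?case using pqD by simp
qed

lemma diexact_extensive: "extensive C"
  unfolding extensive_def
proof (intro conjI)
  show "has_finite_coproducts C"
    unfolding has_finite_coproducts_def using coproduct_exists by blast
  show "finite_coproducts_stable C"
    unfolding finite_coproducts_stable_def using coproduct_stable by blast
  show "finite_coproducts_disjoint C"
    unfolding finite_coproducts_disjoint_def
  proof (intro allI impI, elim conjE)
    fix I :: "nat set" and X S inc
    assume I: "finite I" and cop: "is_coproduct C I X S inc"
    have *: "monic C (inc i) \<and> (\<forall>j\<in>I. \<forall>p q. i \<noteq> j \<and> is_pullback C p q (inc i) (inc j) \<longrightarrow>
      is_initial C (Dom C p))" if i: "i \<in> I" for i
    proof -
      have ins: "is_coproduct C (insert i (I - {i})) X S inc" using cop i by (simp add: insert_absorb)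
      obtain T inc' a b k where T: "is_coproduct C (I - {i}) X T inc'" "a \<in> Hom C Z (X i)" "b \<in> Hom C Z T"
        "k \<in> Hom C T S" "\<And>n. n \<in> I - {i} \<Longrightarrow> k \<cdot> inc' n = inc n" "is_pushout C a b (inc i) k"
        by (rule coproduct_split[OF ins]) (use I in auto)
      have a: "Dom C a = Z" using T by simp
      have "is_initial C (Dom C p)" if "j \<in> I" "i \<noteq> j" and pb: "is_pullback C p q (inc i) (inc j)" for j p q
      proof -
        have j: "j \<in> I - {i}" using that by auto
        note jD = is_coproductD(3-5)[OF T(1) j] and pD = is_pullback_comm[OF pb]
        have "Dom C (inc j) = Dom C (inc' j)" using T(5)[OF j, symmetric] T(4) jD by simp
        then show ?thesis
          using binary_sum_disjoint[OF T(6) a, of p "Dom C p" "inc' j \<cdot> q"]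
            pD Comp_extend[OF T(5)[OF j], of q] T(4) jD by simp
      qed
      then show ?thesis using binary_sum_monic[OF T(6) a] by blast
    qed
    then show "(\<forall>i\<in>I. monic C (inc i)) \<and> (\<forall>i\<in>I. \<forall>j\<in>I. \<forall>p q. i \<noteq> j \<and>
      is_pullback C p q (inc i) (inc j) \<longrightarrow> is_initial C (Dom C p))" by blast
  qed
qed

end

section \<open>Equivalence relations and Barr-exactness of diexact categories\<close>

lemma is_equivalence_relationD:
  assumes eqr: "is_equivalence_relation C r s"
  shows "r \<in> Arr C" "s \<in> Arr C" "Dom C s = Dom C r" "Cod C s = Cod C r"
  using eqr unfolding is_equivalence_relation_def by (auto dest: jointly_monic_span)

lemma is_equivalence_relation_sym:
  assumes eqr: "is_equivalence_relation C r s" and x: "x \<in> Hom C X (Dom C r)"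
  obtains y where "y \<in> Hom C X (Dom C r)" "r \<cdot> y = s \<cdot> x" "s \<cdot> y = r \<cdot> x"
proof -
  obtain i where i: "i \<in> Hom C (Dom C r) (Dom C r)" "r \<cdot> i = s" "s \<cdot> i = r"
    using eqr unfolding is_equivalence_relation_def by blast
  show ?thesis
    using that[of "i \<cdot> x"] Comp_extend[OF i(2), of x] Comp_extend[OF i(3), of x] i(1) x
      is_equivalence_relationD[OF eqr] by simp
qed

lemma is_equivalence_relation_trans:
  assumes eqr: "is_equivalence_relation C r s"
    and xy: "x \<in> Hom C X (Dom C r)" "y \<in> Hom C X (Dom C r)" "s \<cdot> x = r \<cdot> y"
  obtains z where "z \<in> Hom C X (Dom C r)" "r \<cdot> z = r \<cdot> x" "s \<cdot> z = s \<cdot> y"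
proof -
  note rs = is_equivalence_relationD[OF eqr]
  obtain p q t where pq: "is_pullback C p q s r" and t: "t \<in> Hom C (Dom C p) (Dom C r)"
      "r \<cdot> t = r \<cdot> p" "s \<cdot> t = s \<cdot> q"
    using eqr unfolding is_equivalence_relation_def by blast
  note pqD = is_pullback_comm[OF pq]
  obtain w where w: "w \<in> Arr C" "Dom C w = X" "Cod C w = Dom C p" "p \<cdot> w = x" "q \<cdot> w = y"
    using is_pullback_lift[OF pq, of x X y] xy rs by auto
  show ?thesis
    using that[of "t \<cdot> w"] Comp_extend[OF t(2), of w] Comp_extend[OF t(3), of w] t(1) w rs pqD by simp
qed

text \<open>A zigzag reads \<open>x ~ y\<close>, \<open>x' ~ y\<close>, \<open>x' ~ z\<close>.
  Reversing the middle relation and composing gives \<open>x ~ z\<close>.\<close>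

lemma is_equivalence_relation_malcev:
  assumes fc: "finitely_complete C" and eqr: "is_equivalence_relation C r s"
  shows "malcev_span C r s"
proof (rule malcev_spanI[OF fc])
  show "jointly_monic C r s" using eqr by (simp add: is_equivalence_relation_def)
  fix X c1 c2 c3 assume "zigzag C r s X c1 c2 c3"
  then have c: "c1 \<in> Hom C X (Dom C r)" "c2 \<in> Hom C X (Dom C r)" "c3 \<in> Hom C X (Dom C r)"
    "s \<cdot> c1 = s \<cdot> c2" "r \<cdot> c2 = r \<cdot> c3" unfolding zigzag_def by auto
  obtain c2' where c2': "c2' \<in> Hom C X (Dom C r)" "r \<cdot> c2' = s \<cdot> c2" "s \<cdot> c2' = r \<cdot> c2"
    using is_equivalence_relation_sym[OF eqr c(2)] by blast
  obtain z where z: "z \<in> Hom C X (Dom C r)" "r \<cdot> z = r \<cdot> c1" "s \<cdot> z = s \<cdot> c2'"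
    using is_equivalence_relation_trans[OF eqr c(1) c2'(1)] c c2' by auto
  then show "\<exists>c\<in>Hom C X (Dom C r). r \<cdot> c = r \<cdot> c1 \<and> s \<cdot> c = s \<cdot> c3"
    using is_equivalence_relation_trans[OF eqr z(1) c(3)] c c2' z by metis
qed

lemma is_coequalizer_pushout:
  assumes po: "is_pushout C r s e e"
  shows "is_coequalizer C r s e"
proof (rule is_coequalizerI)
  note poD = is_pushout_comm[OF po]
  show s: "Cod C s = Cod C r" using poD by simp
  fix T
  { fix t assume "t \<in> Hom C (Cod C r) T" "t \<cdot> r = t \<cdot> s"
    then show "\<exists>w\<in>Hom C (Cod C e) T. w \<cdot> e = t"
      using is_pushout_lift[OF po, of t T t] s by (metis Hom_iff) }
  { fix w w' assume "w \<in> Hom C (Cod C e) T" "w' \<in> Hom C (Cod C e) T" "w \<cdot> e = w' \<cdot> e"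
    then show "w = w'" using is_pushout_eqI[OF po, of w T w'] by simp }
qed (use is_pushout_comm[OF po] in simp_all)

lemma is_equivalence_relation_pushout:
  assumes eqr: "is_equivalence_relation C r s" and po: "is_pushout C r s h k"
  shows "k = h"
proof -
  obtain d where d: "d \<in> Hom C (Cod C r) (Dom C r)" "r \<cdot> d = Id C (Cod C r)" "s \<cdot> d = Id C (Cod C r)"
    using eqr unfolding is_equivalence_relation_def by blast
  note [simp] = is_pushout_comm(1-8)[OF po]
  have "Cod C s = Cod C r" using is_equivalence_relationD[OF eqr] by simp
  then show ?thesis
    using Comp_extend[OF is_pushout_comm(9)[OF po], of d] d is_equivalence_relationD[OF eqr] by simp
qed

lemma is_kernel_pair_equivalence:
  assumes fc: "finitely_complete C" and kp: "is_kernel_pair C r s f"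
  shows "is_equivalence_relation C r s"
proof -
  have pb: "is_pullback C r s f f" using kp by (simp add: is_kernel_pair_def)
  note [simp] = is_pullback_comm(1-3,5-7)[OF pb]
  note eq = is_pullback_comm(9)[OF pb]
  obtain d where d: "d \<in> Hom C (Dom C f) (Dom C r)" "r \<cdot> d = Id C (Dom C f)" "s \<cdot> d = Id C (Dom C f)"
    using is_pullback_lift[OF pb, of "Id C (Dom C f)" "Dom C f" "Id C (Dom C f)"] by auto
  obtain i where i: "i \<in> Hom C (Dom C r) (Dom C r)" "r \<cdot> i = s" "s \<cdot> i = r"
    using is_pullback_lift[OF pb, of s "Dom C r" r] eq by auto
  obtain p q where pq: "is_pullback C p q s r" using pullback_exists[OF fc, of s r] by auto
  note pqD [simp] = is_pullback_comm(1,2,5-7)[OF pq]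
  have "f \<cdot> (r \<cdot> p) = f \<cdot> (s \<cdot> q)"
    using Comp_extend[OF eq, of p] Comp_extend[OF eq, of q] is_pullback_comm(9)[OF pq] by simp
  then obtain t where "t \<in> Hom C (Dom C p) (Dom C r)" "r \<cdot> t = r \<cdot> p" "s \<cdot> t = s \<cdot> q"
    using is_pullback_lift[OF pb, of "r \<cdot> p" "Dom C p" "s \<cdot> q"] by auto
  then show ?thesis
    unfolding is_equivalence_relation_def
    using is_pullback_jointly_monic[OF pb] d i pq by auto
qed

text \<open>The arrow \<open>e\<close> is a coequalizer of some pair \<open>r0\<close>,
  \<open>s0\<close>, not by definition of its kernel pair; but that pair factors through the kernel
  pair by \<open>w\<close>. The diagonal \<open>d\<close> forces the two arrows \<open>u\<close>,
  \<open>v\<close> of a cocone to be equal, so the pushout reduces to the coequalizer.\<close>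

lemma regular_epi_kernel_pair_pushout:
  assumes fc: "finitely_complete C" and e: "regular_epi C e" and pb: "is_pullback C r s e e"
  shows "is_pushout C r s e e"
proof -
  obtain r0 s0 where co: "is_coequalizer C r0 s0 e" using e by (auto simp: regular_epi_def)
  note [simp] = is_pullback_comm(1-3,5-7)[OF pb]
  note coD = is_coequalizerD[OF co]
  have eqr: "is_equivalence_relation C r s"
    using is_kernel_pair_equivalence[OF fc] pb by (simp add: is_kernel_pair_def)
  obtain d where d: "d \<in> Hom C (Dom C e) (Dom C r)" "r \<cdot> d = Id C (Dom C e)" "s \<cdot> d = Id C (Dom C e)"
    using eqr unfolding is_equivalence_relation_def by auto
  obtain w where w: "w \<in> Hom C (Dom C r0) (Dom C r)" "r \<cdot> w = r0" "s \<cdot> w = s0"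
    using is_pullback_lift[OF pb, of r0 "Dom C r0" s0] coD by auto
  show ?thesis
  proof (rule is_pushoutI)
    show "comm_square C r s e e" using is_pullback_comm[OF pb] by (simp add: comm_square_def)
    fix T
    { fix u v assume uv: "u \<in> Hom C (Cod C r) T" "v \<in> Hom C (Cod C s) T" "u \<cdot> r = v \<cdot> s"
      have "u = v" using Comp_extend[OF uv(3), of d] d uv by simp
      moreover have "u \<cdot> r0 = u \<cdot> s0"
        using Comp_extend[OF uv(3), of w] w uv(1,2) calculation by simp
      ultimately show "\<exists>w\<in>Hom C (Cod C e) T. w \<cdot> e = u \<and> w \<cdot> e = v"
        using is_coequalizer_lift[OF co, of u T] uv(1) coD(6) is_pullback_comm(6)[OF pb] by (metis Hom_iff) }
    { fix w w' assume "w \<in> Hom C (Cod C e) T" "w' \<in> Hom C (Cod C e) T" "w \<cdot> e = w' \<cdot> e"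
      then show "w = w'" by (rule is_coequalizer_epi[OF co]) }
  qed
qed

lemma diexact_barr_exact:
  assumes dx: "diexact C"
  shows "barr_exact C"
proof -
  have fc: "finitely_complete C" using dx by (simp add: diexact_def)
  have quot: "\<exists>e. is_coequalizer C r s e \<and> is_kernel_pair C r s e"
    if eqr: "is_equivalence_relation C r s" for r s
  proof -
    have "malcev_span C r s" by (rule is_equivalence_relation_malcev[OF fc eqr])
    then obtain h k where hk: "is_pushout C r s h k" "is_pullback C r s h k"
      using dx unfolding diexact_def by blast
    then show ?thesis
      using is_equivalence_relation_pushout[OF eqr hk(1)] is_coequalizer_pushout
      by (auto simp: is_kernel_pair_def)
  qed
  \<comment> \<open>Both legs of the pushout of the kernel pair are \<open>e\<close>, so one
    pullback along \<open>x\<close> serves for both. Stability then gives a pushout with both legs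
    \<open>q\<close>, which is a coequalizer.\<close>
  have stable: "regular_epi C q" if e: "regular_epi C e" and pb: "is_pullback C p q e x" for p q e x
  proof -
    obtain r s where rs: "is_pullback C r s e e"
      using pullback_exists[OF fc, of e e] regular_epi_Arr[OF e] by blast
    have "malcev_span C r s"
      using is_equivalence_relation_malcev[OF fc is_kernel_pair_equivalence[OF fc]] rs
      by (simp add: is_kernel_pair_def)
    then have "stable_pushout C r s e e"
      using dx regular_epi_kernel_pair_pushout[OF fc e rs] unfolding diexact_def by blast
    then show ?thesis
      using stable_pushout_pullback[OF fc _ pb pb] is_coequalizer_pushout
      unfolding regular_epi_def by metis
  qed
  show ?thesis
    unfolding barr_exact_def regular_def
    using fc quot stable is_kernel_pair_equivalence[OF fc] by blast
qed


section \<open>Covers\<close>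

text \<open>\<open>covers X P\<close>: the arrows into \<open>X\<close> satisfying \<open>P\<close> contain a family composed of regular
  epimorphisms and coproduct injections; if \<open>X\<close> is initial, every \<open>P\<close> qualifies.\<close>

inductive covers :: "'o \<Rightarrow> ('a \<Rightarrow> bool) \<Rightarrow> bool" where
  covers_Id: "X \<in> Obj C \<Longrightarrow> P (Id C X) \<Longrightarrow> covers X P"
| covers_epi: "regular_epi C e \<Longrightarrow> covers (Dom C e) (\<lambda>y. P (e \<cdot> y)) \<Longrightarrow> covers (Cod C e) P"
| covers_coproduct: "is_coproduct C (I :: nat set) Y X inc \<Longrightarrow>
    (\<And>i. i \<in> I \<Longrightarrow> covers (Y i) (\<lambda>y. P (inc i \<cdot> y))) \<Longrightarrow> covers X P"

lemma covers_mono: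
  assumes "covers X P" "\<And>Y y. y \<in> Hom C Y X \<Longrightarrow> P y \<Longrightarrow> Q y"
  shows "covers X Q"
  using assms
proof (induction arbitrary: Q)
  case (covers_Id X P)
  show ?case by (rule covers.covers_Id) (use covers_Id in simp_all)
next
  case (covers_epi e P)
  note e = regular_epi_Arr[OF covers_epi(1)]
  show ?case
    by (rule covers.covers_epi[OF covers_epi(1)], rule covers_epi.IH, rule covers_epi.prems) (use e in auto)
next
  case (covers_coproduct I Y X inc P)
  show ?case
  proof (rule covers.covers_coproduct[OF covers_coproduct(1)])
    fix i assume i: "i \<in> I"
    note inc = is_coproductD(3-5)[OF covers_coproduct(1) i]
    show "covers (Y i) (\<lambda>y. Q (inc i \<cdot> y))"
      by (rule covers_coproduct.IH[OF i], rule covers_coproduct.prems) (use inc in auto)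
  qed
qed

text \<open>Covers are jointly epic because regular epimorphisms are epic and coproduct injections
  are jointly epic. On an initial object the empty coproduct makes the local condition
  vacuous.\<close>

lemma covers_eqI:
  assumes "covers X P" "t \<in> Hom C X T" "t' \<in> Hom C X T"
    "\<And>Y y. y \<in> Hom C Y X \<Longrightarrow> P y \<Longrightarrow> t \<cdot> y = t' \<cdot> y"
  shows "t = t'"
  using assms
proof (induction arbitrary: t t')
  case (covers_Id X P)
  then show ?case using covers_Id(5)[of "Id C X" X] by simp
next
  case (covers_epi e P)
  note e = regular_epi_Arr[OF covers_epi(1)]
  have "t \<cdot> e = t' \<cdot> e"
  proof (rule covers_epi.IH)
    fix Y y assume y: "y \<in> Hom C Y (Dom C e)" and "P (e \<cdot> y)"
    then have "t \<cdot> (e \<cdot> y) = t' \<cdot> (e \<cdot> y)" using covers_epi(6)[of "e \<cdot> y" Y] e by simp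
    then show "(t \<cdot> e) \<cdot> y = (t' \<cdot> e) \<cdot> y" using y e covers_epi(4,5) by simp
  qed (use covers_epi(4,5) e in simp_all)
  then show ?case using regular_epi_epi[OF covers_epi(1)] covers_epi(4,5) by blast
next
  case (covers_coproduct I Y X inc P)
  show ?case
  proof (rule is_coproduct_eqI[OF covers_coproduct(1,4,5)])
    fix i assume i: "i \<in> I"
    note inc = is_coproductD(3-5)[OF covers_coproduct(1) i]
    show "t \<cdot> inc i = t' \<cdot> inc i"
    proof (rule covers_coproduct.IH[OF i])
      fix Z y assume y: "y \<in> Hom C Z (Y i)" and "P (inc i \<cdot> y)"
      then have "t \<cdot> (inc i \<cdot> y) = t' \<cdot> (inc i \<cdot> y)" using covers_coproduct(6)[of "inc i \<cdot> y" Z] inc by simp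
      then show "(t \<cdot> inc i) \<cdot> y = (t' \<cdot> inc i) \<cdot> y" using y inc covers_coproduct(4,5) by simp
    qed (use covers_coproduct(4,5) inc in simp_all)
  qed
qed

text \<open>Lifts through a jointly monic pair are unique, so local lifts are compatible and glue.
  This allows subobject membership to be tested on a cover.\<close>

lemma covers_lift:
  assumes "covers X P" and jm: "jointly_monic C r s"
    and "u \<in> Hom C X (Cod C r)" "v \<in> Hom C X (Cod C s)"
    and "\<And>Y y. y \<in> Hom C Y X \<Longrightarrow> P y \<Longrightarrow> \<exists>w \<in> Hom C Y (Dom C r). r \<cdot> w = u \<cdot> y \<and> s \<cdot> w = v \<cdot> y"
  shows "\<exists>w \<in> Hom C X (Dom C r). r \<cdot> w = u \<and> s \<cdot> w = v"
  using assms(1,3-)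
proof (induction arbitrary: u v)
  case (covers_Id X P)
  then show ?case using covers_Id(5)[of "Id C X" X] by simp
next
  case (covers_epi e P)
  note e = regular_epi_Arr[OF covers_epi(1)]
  note rs [simp] = jointly_monic_span[OF jm]
  have [simp]: "u \<in> Arr C" "v \<in> Arr C" "Dom C u = Cod C e" "Dom C v = Cod C e" "Cod C u = Cod C r"
    "Cod C v = Cod C s" using covers_epi(4,5) by simp_all
  have "\<exists>w \<in> Hom C (Dom C e) (Dom C r). r \<cdot> w = u \<cdot> e \<and> s \<cdot> w = v \<cdot> e"
  proof (rule covers_epi.IH)
    fix Y y assume y: "y \<in> Hom C Y (Dom C e)" and "P (e \<cdot> y)"
    then show "\<exists>w \<in> Hom C Y (Dom C r). r \<cdot> w = (u \<cdot> e) \<cdot> y \<and> s \<cdot> w = (v \<cdot> e) \<cdot> y"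
      using covers_epi(6)[of "e \<cdot> y" Y] e by simp
  qed (use e in simp_all)
  then obtain w where w: "w \<in> Arr C" "Dom C w = Dom C e" "Cod C w = Dom C r"
    and rw: "r \<cdot> w = u \<cdot> e" and sw: "s \<cdot> w = v \<cdot> e" by auto
  obtain r0 s0 where co: "is_coequalizer C r0 s0 e" using covers_epi(1) by (auto simp: regular_epi_def)
  note coD = is_coequalizerD[OF co]
  \<comment> \<open>Both sides lift the same pair, because \<open>u \<cdot> e\<close> and
    \<open>v \<cdot> e\<close> coequalize \<open>r0\<close> and \<open>s0\<close>; so
    \<open>w\<close> descends along \<open>e\<close>.\<close>
  have "w \<cdot> r0 = w \<cdot> s0"
    by (rule jointly_monicD[OF jm, of _ "Dom C r0"])
      (use w coD Comp_extend[OF rw, of r0] Comp_extend[OF rw, of s0]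
        Comp_extend[OF sw, of r0] Comp_extend[OF sw, of s0] in simp_all)
  then obtain z where z: "z \<in> Arr C" "Dom C z = Cod C e" "Cod C z = Dom C r" "z \<cdot> e = w"
    using is_coequalizer_lift[OF co, of w "Dom C r"] w coD(6) by (metis Hom_iff)
  have "r \<cdot> z = u" "s \<cdot> z = v"
    by (rule is_coequalizer_epi[OF co], use z e rw sw in simp_all)+
  then show ?case using z by (intro bexI[of _ z]) simp_all
next
  case (covers_coproduct I Y X inc P)
  note rs [simp] = jointly_monic_span[OF jm]
  have [simp]: "u \<in> Arr C" "v \<in> Arr C" "Dom C u = X" "Dom C v = X" "Cod C u = Cod C r"
    "Cod C v = Cod C s" using covers_coproduct(4,5) by simp_all
  have "\<exists>w \<in> Hom C (Y i) (Dom C r). r \<cdot> w = u \<cdot> inc i \<and> s \<cdot> w = v \<cdot> inc i" if i: "i \<in> I" for i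
  proof -
    note inc = is_coproductD(3-5)[OF covers_coproduct(1) i]
    show ?thesis
    proof (rule covers_coproduct.IH[OF i])
      fix Z y assume y: "y \<in> Hom C Z (Y i)" and "P (inc i \<cdot> y)"
      then show "\<exists>w \<in> Hom C Z (Dom C r). r \<cdot> w = (u \<cdot> inc i) \<cdot> y \<and> s \<cdot> w = (v \<cdot> inc i) \<cdot> y"
        using covers_coproduct(6)[of "inc i \<cdot> y" Z] inc by simp
    qed (use inc in simp_all)
  qed
  then obtain w where w: "\<And>i. i \<in> I \<Longrightarrow> w i \<in> Hom C (Y i) (Dom C r)"
    "\<And>i. i \<in> I \<Longrightarrow> r \<cdot> w i = u \<cdot> inc i" "\<And>i. i \<in> I \<Longrightarrow> s \<cdot> w i = v \<cdot> inc i" by metis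
  have "Dom C r \<in> Obj C" by simp
  then obtain z where z: "z \<in> Arr C" "Dom C z = X" "Cod C z = Dom C r" "\<And>i. i \<in> I \<Longrightarrow> z \<cdot> inc i = w i"
    using is_coproduct_lift[OF covers_coproduct(1) _ w(1)] by blast
  have "(r \<cdot> z) \<cdot> inc i = u \<cdot> inc i" "(s \<cdot> z) \<cdot> inc i = v \<cdot> inc i" if i: "i \<in> I" for i
    using is_coproductD(3-5)[OF covers_coproduct(1) i] z(1-3) z(4)[OF i] w(2,3)[OF i] by simp_all
  then have "r \<cdot> z = u" "s \<cdot> z = v"
    using is_coproduct_eqI[OF covers_coproduct(1), of "r \<cdot> z" "Cod C r" u]
      is_coproduct_eqI[OF covers_coproduct(1), of "s \<cdot> z" "Cod C s" v] z(1-3) by simp_all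
  then show ?case using z by (intro bexI[of _ z]) simp_all
qed

section \<open>Pretoposes\<close>

context
  assumes pt: "pretopos C"
begin

lemma pretopos_finitely_complete: "finitely_complete C"
  using pt by (simp add: pretopos_def)

lemma pretopos_regular_epi_pullback: "regular_epi C e \<Longrightarrow> is_pullback C p q e x \<Longrightarrow> regular_epi C q"
  using pt unfolding pretopos_def barr_exact_def regular_def by blast

lemma pretopos_coequalizer:
  "is_pullback C r s f f \<Longrightarrow> \<exists>e. is_coequalizer C r s e"
  using pt unfolding pretopos_def barr_exact_def regular_def is_kernel_pair_def by blast

text \<open>Exactness presents the relation as the kernel pair of some \<open>f\<close>. This
  \<open>f\<close> factors through the coequalizer \<open>q\<close>, so whatever \<open>q\<close>
  identifies is identified by \<open>f\<close>, and \<open>q\<close> has the same kernel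
  pair.\<close>

lemma pretopos_quotient:
  assumes eqr: "is_equivalence_relation C r s"
  obtains q where "is_coequalizer C r s q" "is_pullback C r s q q"
proof -
  obtain f where f: "is_pullback C r s f f"
    using pt eqr unfolding pretopos_def barr_exact_def is_kernel_pair_def by blast
  obtain q where q: "is_coequalizer C r s q" using pretopos_coequalizer[OF f] ..
  note fD = is_pullback_comm[OF f] and qD = is_coequalizerD[OF q]
  obtain n where n: "n \<in> Arr C" "Dom C n = Cod C q" "Cod C n = Cod C f" "n \<cdot> q = f"
    by (rule is_coequalizer_lift[OF q, of f "Cod C f"]) (use fD in simp_all)
  have "is_pullback C r s q q"
  proof (rule is_pullbackI)
    show "comm_square C r s q q" using qD by (simp add: comm_square_def)
    fix X
    { fix u v assume uv: "u \<in> Hom C X (Dom C q)" "v \<in> Hom C X (Dom C q)" "q \<cdot> u = q \<cdot> v"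
      have "f \<cdot> u = f \<cdot> v"
        using Comp_extend[OF n(4), of u] Comp_extend[OF n(4), of v] uv n qD by simp
      then show "\<exists>w\<in>Hom C X (Dom C r). r \<cdot> w = u \<and> s \<cdot> w = v"
        using is_pullback_lift[OF f, of u X v] uv fD qD by (metis Hom_iff) }
    { fix w w' assume "w \<in> Hom C X (Dom C r)" "w' \<in> Hom C X (Dom C r)" "r \<cdot> w = r \<cdot> w'" "s \<cdot> w = s \<cdot> w'"
      then show "w = w'" by (rule is_pullback_eqI[OF f]) }
  qed
  then show ?thesis using that q by blast
qed

lemma pretopos_coproduct:
  "finite (I :: nat set) \<Longrightarrow> (\<And>i. i \<in> I \<Longrightarrow> X i \<in> Obj C) \<Longrightarrow> \<exists>S inc. is_coproduct C I X S inc"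
  using pt unfolding pretopos_def extensive_def has_finite_coproducts_def by blast

lemma pretopos_coproduct_stable:
  "finite (I :: nat set) \<Longrightarrow> is_coproduct C I X S inc \<Longrightarrow> x \<in> Arr C \<Longrightarrow> Cod C x = S \<Longrightarrow>
    (\<And>i. i \<in> I \<Longrightarrow> is_pullback C (p i) (q i) (inc i) x) \<Longrightarrow>
    is_coproduct C I (\<lambda>i. Dom C (q i)) (Dom C x) q"
  using pt unfolding pretopos_def extensive_def finite_coproducts_stable_def by blast

text \<open>Strictness is stability of the empty coproduct under pullback along \<open>f\<close>;
  with no summands the pullback condition is vacuous.\<close>

lemma pretopos_initial_dom:
  assumes "f \<in> Arr C" "is_initial C (Cod C f)"
  shows "is_initial C (Dom C f)"
  using pretopos_coproduct_stable[of "{}" undefined "Cod C f" undefined f] assms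
  by (simp add: is_initial_empty_coproduct)

lemma pretopos_strict_initial: "\<exists>Z. is_strict_initial C Z"
proof -
  obtain Z where Z: "is_initial C Z"
    using pretopos_coproduct[of "{}"] by (auto simp: is_initial_empty_coproduct)
  have "invertible C f" if f: "f \<in> Arr C" "Cod C f = Z" for f
  proof -
    have X: "is_initial C (Dom C f)" using pretopos_initial_dom f Z by simp
    have "Dom C f \<in> Obj C" using f by simp
    then obtain g where g: "g \<in> Arr C" "Dom C g = Z" "Cod C g = Dom C f"
      by (rule is_initial_lift[OF Z])
    have "g \<cdot> f = Id C (Dom C f)" by (rule is_initial_eqI[OF X, of _ "Dom C f"]) (use f g in simp_all)
    moreover have "f \<cdot> g = Id C (Cod C f)"
      by (rule is_initial_eqI[OF Z, of _ Z]) (use f g Cod_in_Obj[of f] in simp_all)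
    ultimately show ?thesis unfolding invertible_def using f g by auto
  qed
  then show ?thesis using Z unfolding is_strict_initial_def by blast
qed

text \<open>Disjointness is recast for generalized elements: an element common to both summands
  gives an arrow to the pullback of the injections, which is initial, and initial objects are
  strict.\<close>

lemma pretopos_sum:
  assumes "A \<in> Obj C" "B \<in> Obj C"
  obtains S i j where
    "is_coproduct C {0, 1 :: nat} (\<lambda>n. if n = 0 then A else B) S (\<lambda>n. if n = 0 then i else j)"
    "monic C i" "monic C j"
    "\<And>X u v. u \<in> Hom C X A \<Longrightarrow> v \<in> Hom C X B \<Longrightarrow> i \<cdot> u = j \<cdot> v \<Longrightarrow> is_initial C X"
proof -
  let ?X = "\<lambda>n. if n = (0::nat) then A else B" and ?I = "{0, 1 :: nat}"
  have "\<exists>S inc. is_coproduct C ?I ?X S inc"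
    by (rule pretopos_coproduct) (use assms in auto)
  then obtain S inc where cop: "is_coproduct C ?I ?X S inc" by blast
  have disj: "(\<forall>i\<in>?I. monic C (inc i)) \<and> (\<forall>i\<in>?I. \<forall>j\<in>?I. \<forall>p q. i \<noteq> j \<and>
      is_pullback C p q (inc i) (inc j) \<longrightarrow> is_initial C (Dom C p))"
    using pt cop unfolding pretopos_def extensive_def finite_coproducts_disjoint_def
    by (meson finite.intros)
  note inc0 = is_coproductD(3-5)[OF cop, of 0, simplified] and inc1 = is_coproductD(3-5)[OF cop, of 1, simplified]
  obtain p q where pq: "is_pullback C p q (inc 0) (inc 1)"
    using pullback_exists[OF pretopos_finitely_complete, of "inc 0" "inc 1"] inc0 inc1 by auto
  have init: "is_initial C (Dom C p)" using disj pq by force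
  show ?thesis
  proof (rule that[of S "inc 0" "inc 1"])
    show "is_coproduct C ?I ?X S (\<lambda>n. if n = 0 then inc 0 else inc 1)"
      using cop by (simp add: is_coproduct_def)
    show "monic C (inc 0)" "monic C (inc 1)" using disj by auto
    fix X u v assume "u \<in> Hom C X A" "v \<in> Hom C X B" "inc 0 \<cdot> u = inc 1 \<cdot> v"
    then obtain w where "w \<in> Arr C" "Dom C w = X" "Cod C w = Dom C p"
      using is_pullback_lift[OF pq, of u X v] inc0 inc1 by auto
    then show "is_initial C X" using pretopos_initial_dom init by metis
  qed
qed

text \<open>Constructs the union of finitely many relations on \<open>S\<close>: the spans are
  assembled into one arrow \<open>d : V -> S x S\<close> from the coproduct of their vertices, and
  its image is taken as the coequalizer \<open>e\<close> of its kernel pair followed by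
  \<open>m\<close>. Membership in the union is only local: it takes a lift along \<open>e\<close>
  and then a choice of summand.\<close>

lemma relation_image:
  assumes I: "finite (I :: nat set)" and S: "S \<in> Obj C"
    and d0: "\<And>k. k \<in> I \<Longrightarrow> d0 k \<in> Hom C (W k) S" and d1: "\<And>k. k \<in> I \<Longrightarrow> d1 k \<in> Hom C (W k) S"
  obtains e1 e2 where "jointly_monic C e1 e2" "Cod C e1 = S" "Cod C e2 = S"
    "\<And>k. k \<in> I \<Longrightarrow> \<exists>w \<in> Hom C (W k) (Dom C e1). e1 \<cdot> w = d0 k \<and> e2 \<cdot> w = d1 k"
    "\<And>X w. w \<in> Hom C X (Dom C e1) \<Longrightarrow> covers X (\<lambda>x. \<exists>k \<in> I. \<exists>c \<in> Hom C (Dom C x) (W k).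
      e1 \<cdot> (w \<cdot> x) = d0 k \<cdot> c \<and> e2 \<cdot> (w \<cdot> x) = d1 k \<cdot> c)"
proof -
  note fc = pretopos_finitely_complete
  have "W k \<in> Obj C" if "k \<in> I" for k using d0[OF that] Dom_in_Obj[of "d0 k"] by simp
  then obtain V inc where cop: "is_coproduct C I W V inc" using pretopos_coproduct[OF I] by blast
  note inc = is_coproductD(3-5)[OF cop]
  obtain D0 where D0: "D0 \<in> Arr C" "Dom C D0 = V" "Cod C D0 = S" "\<And>k. k \<in> I \<Longrightarrow> D0 \<cdot> inc k = d0 k"
    using is_coproduct_lift[OF cop S d0] by blast
  obtain D1 where D1: "D1 \<in> Arr C" "Dom C D1 = V" "Cod C D1 = S" "\<And>k. k \<in> I \<Longrightarrow> D1 \<cdot> inc k = d1 k"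
    using is_coproduct_lift[OF cop S d1] by blast
  obtain p q where pq: "p \<in> Arr C" "q \<in> Arr C" "Dom C q = Dom C p" "Cod C p = S" "Cod C q = S"
    "\<And>X u v. u \<in> Hom C X S \<Longrightarrow> v \<in> Hom C X S \<Longrightarrow> \<exists>w \<in> Hom C X (Dom C p). p \<cdot> w = u \<and> q \<cdot> w = v"
    "jointly_monic C p q"
    using product_exists[OF fc S S] by metis
  obtain d where d: "d \<in> Arr C" "Dom C d = V" "Cod C d = Dom C p" "p \<cdot> d = D0" "q \<cdot> d = D1"
    using pq(6)[of D0 V D1] D0 D1 by auto
  obtain r s where rs: "is_pullback C r s d d" using pullback_exists[OF fc, of d d] d by auto
  obtain e where co: "is_coequalizer C r s e" using pretopos_coequalizer[OF rs] ..
  note rsD = is_pullback_comm[OF rs] and coD = is_coequalizerD[OF co]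
  have re: "regular_epi C e" using co by (auto simp: regular_epi_def)
  have eV: "Dom C e = V" using coD(6) rsD(6) d(2) by simp
  obtain m where m: "m \<in> Arr C" "Dom C m = Cod C e" "Cod C m = Dom C p" "m \<cdot> e = d"
    by (rule is_coequalizer_lift[OF co, of d "Dom C p"]) (use d rsD in simp_all)
  note [simp] = coD(3) eV m(1-3) pq(1-5) D0(1-3) D1(1-3) d(1-3)
  \<comment> \<open>The image part \<open>m\<close> is shown monic. After pulling back
    \<open>e\<close> twice, both \<open>u\<close> and \<open>v\<close> lift to \<open>V\<close>. The
    lifts have the same image under \<open>d\<close>, so they form an element of its kernel pair and
    \<open>e\<close> identifies them. The regular epimorphisms \<open>x2\<close> and
    \<open>x1\<close> are then cancelled.\<close>
  have jm: "jointly_monic C (p \<cdot> m) (q \<cdot> m)"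
  proof (rule jointly_monicI)
    fix X u v assume u: "u \<in> Hom C X (Dom C (p \<cdot> m))" and v: "v \<in> Hom C X (Dom C (p \<cdot> m))"
      and eq: "(p \<cdot> m) \<cdot> u = (p \<cdot> m) \<cdot> v" "(q \<cdot> m) \<cdot> u = (q \<cdot> m) \<cdot> v"
    have uv [simp]: "u \<in> Arr C" "v \<in> Arr C" "Dom C u = X" "Dom C v = X" "Cod C u = Cod C e" "Cod C v = Cod C e"
      using u v by simp_all
    have muv: "m \<cdot> u = m \<cdot> v"
      by (rule jointly_monicD[OF pq(7), of _ X]) (use eq in simp_all)
    obtain w1 x1 where 1: "is_pullback C w1 x1 e u" using pullback_exists[OF fc, of e u] by auto
    note 1 [simp] = is_pullback_comm[OF 1] pretopos_regular_epi_pullback[OF re 1]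
    obtain w2 x2 where 2: "is_pullback C w2 x2 e (v \<cdot> x1)"
      using pullback_exists[OF fc, of e "v \<cdot> x1"] by auto
    have x2: "regular_epi C x2" using pretopos_regular_epi_pullback[OF re 2] .
    have 2 [simp]: "w2 \<in> Arr C" "x2 \<in> Arr C" "Dom C x2 = Dom C w2" "Cod C w2 = V" "Cod C x2 = Dom C w1"
      "e \<cdot> w2 = v \<cdot> (x1 \<cdot> x2)"
      using is_pullback_comm[OF 2] by simp_all
    have ew1: "e \<cdot> (w1 \<cdot> x2) = u \<cdot> (x1 \<cdot> x2)" using Comp_extend[OF 1(9), of x2] by simp
    have "d \<cdot> (w1 \<cdot> x2) = d \<cdot> w2"
      using Comp_extend[OF m(4), of "w1 \<cdot> x2"] Comp_extend[OF m(4), of w2] ew1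
        Comp_extend[OF muv, of "x1 \<cdot> x2"] by simp
    then obtain z where z: "z \<in> Arr C" "Dom C z = Dom C w2" "Cod C z = Dom C r" "r \<cdot> z = w1 \<cdot> x2" "s \<cdot> z = w2"
      using is_pullback_lift[OF rs, of "w1 \<cdot> x2" "Dom C w2" w2] by auto
    have "e \<cdot> (r \<cdot> z) = e \<cdot> (s \<cdot> z)"
      using Comp_extend[OF coD(7), of z] z coD by simp
    then have *: "u \<cdot> (x1 \<cdot> x2) = v \<cdot> (x1 \<cdot> x2)" using ew1 z(4,5) by simp
    have "u \<cdot> x1 = v \<cdot> x1"
      by (rule regular_epi_epi[OF x2, of _ "Cod C e"]) (use * in simp_all)
    then show "u = v"
      by (intro regular_epi_epi[OF 1(10), of u "Cod C e" v]) simp_all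
  qed simp_all
  show ?thesis
  proof (rule that[OF jm])
    show "Cod C (p \<cdot> m) = S" "Cod C (q \<cdot> m) = S" by simp_all
    have pme: "p \<cdot> (m \<cdot> (e \<cdot> z)) = D0 \<cdot> z" "q \<cdot> (m \<cdot> (e \<cdot> z)) = D1 \<cdot> z"
      if "z \<in> Arr C" "Cod C z = V" for z
      using Comp_extend[OF m(4), of z] Comp_extend[OF d(4), of z] Comp_extend[OF d(5), of z] that by simp_all
    { fix k assume k: "k \<in> I"
      then show "\<exists>w \<in> Hom C (W k) (Dom C (p \<cdot> m)). (p \<cdot> m) \<cdot> w = d0 k \<and> (q \<cdot> m) \<cdot> w = d1 k"
        using inc[OF k] D0(4)[OF k] D1(4)[OF k] pme[of "inc k"] by (intro bexI[of _ "e \<cdot> inc k"]) simp_all }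
    fix X w assume "w \<in> Hom C X (Dom C (p \<cdot> m))"
    then have w [simp]: "w \<in> Arr C" "Dom C w = X" "Cod C w = Cod C e" by simp_all
    \<comment> \<open>The cover of \<open>X\<close>: the pullback of \<open>e\<close> along
      \<open>w\<close>, followed by the pullbacks along \<open>v\<close> of the injections into
      \<open>V\<close>.\<close>
    obtain v x where v: "is_pullback C v x e w" using pullback_exists[OF fc, of e w] by auto
    have x: "regular_epi C x" using pretopos_regular_epi_pullback[OF re v] .
    note vD [simp] = is_pullback_comm(1,2,5-7)[OF v]
    have "\<exists>c y. is_pullback C c y (inc k) v" if "k \<in> I" for k
      by (rule pullback_exists[OF fc, of "inc k" v]) (use inc[OF that] in auto)
    then obtain c y where cy: "\<And>k. k \<in> I \<Longrightarrow> is_pullback C (c k) (y k) (inc k) v" by metis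
    have cop': "is_coproduct C I (\<lambda>k. Dom C (y k)) (Dom C v) y"
      by (rule pretopos_coproduct_stable[OF I cop _ _ cy]) simp_all
    let ?P = "\<lambda>x. \<exists>k \<in> I. \<exists>c \<in> Hom C (Dom C x) (W k).
      (p \<cdot> m) \<cdot> (w \<cdot> x) = d0 k \<cdot> c \<and> (q \<cdot> m) \<cdot> (w \<cdot> x) = d1 k \<cdot> c"
    have "covers (Dom C x) (\<lambda>z. ?P (x \<cdot> z))"
      unfolding vD(3)
    proof (rule covers_coproduct[OF cop'])
      fix k assume k: "k \<in> I"
      note inck [simp] = inc[OF k]
      note cyD = is_pullback_comm[OF cy[OF k]]
      have [simp]: "c k \<in> Arr C" "y k \<in> Arr C" "Dom C (c k) = Dom C (y k)" "Cod C (c k) = W k"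
        "Cod C (y k) = Dom C v"
        using cyD by simp_all
      have "w \<cdot> (x \<cdot> y k) = e \<cdot> (v \<cdot> y k)"
        using Comp_extend[OF is_pullback_comm(9)[OF v], of "y k"] by simp
      then have wxy: "w \<cdot> (x \<cdot> y k) = e \<cdot> (inc k \<cdot> c k)" using cyD(9) by simp
      have "p \<cdot> (m \<cdot> (w \<cdot> (x \<cdot> y k))) = d0 k \<cdot> c k" "q \<cdot> (m \<cdot> (w \<cdot> (x \<cdot> y k))) = d1 k \<cdot> c k"
        unfolding wxy using pme[of "inc k \<cdot> c k"] Comp_extend[OF D0(4)[OF k], of "c k"]
          Comp_extend[OF D1(4)[OF k], of "c k"] by simp_all
      then show "covers (Dom C (y k)) (\<lambda>z. ?P (x \<cdot> (y k \<cdot> z)))"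
        by (intro covers_Id bexI[of _ k] bexI[of _ "c k"]) (use k in simp_all)
    qed
    then have "covers (Cod C x) ?P" by (rule covers_epi[OF x])
    then show "covers X ?P" by simp
  qed
qed

end
end

text \<open>The equivalence relation generated on a disjoint union by a difunctional relation \<open>H\<close>, with
  legs \<open>F\<close> and \<open>G\<close> into the two summands.\<close>

inductive difunctional_closure :: "'c set \<Rightarrow> ('c \<Rightarrow> 's) \<Rightarrow> ('c \<Rightarrow> 's) \<Rightarrow> 's \<Rightarrow> 's \<Rightarrow> bool"
  for H F G where
  refl: "u = v \<Longrightarrow> difunctional_closure H F G u v"
| FG: "c \<in> H \<Longrightarrow> u = F c \<Longrightarrow> v = G c \<Longrightarrow> difunctional_closure H F G u v"
| GF: "c \<in> H \<Longrightarrow> u = G c \<Longrightarrow> v = F c \<Longrightarrow> difunctional_closure H F G u v"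
| FF: "c \<in> H \<Longrightarrow> c' \<in> H \<Longrightarrow> G c = G c' \<Longrightarrow> u = F c \<Longrightarrow> v = F c' \<Longrightarrow> difunctional_closure H F G u v"
| GG: "c \<in> H \<Longrightarrow> c' \<in> H \<Longrightarrow> F c = F c' \<Longrightarrow> u = G c \<Longrightarrow> v = G c' \<Longrightarrow> difunctional_closure H F G u v"

lemma difunctional_closure_swap:
  "difunctional_closure H F G u v \<Longrightarrow> difunctional_closure H G F u v"
  by (induction rule: difunctional_closure.induct) (auto intro: difunctional_closure.intros)

lemma difunctional_closure_sym:
  "difunctional_closure H F G u v \<Longrightarrow> difunctional_closure H F G v u"
  by (induction rule: difunctional_closure.induct) (auto intro: difunctional_closure.intros)

text \<open>Prepends one step from \<open>F c\<close> to \<open>G c\<close>. Disjointness excludes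
  relations that start in the image of \<open>F\<close>; difunctionality is used when
  \<open>G c\<close> is related to another value of \<open>G\<close>.\<close>

lemma difunctional_closure_FG_trans:
  assumes disj: "\<And>c c'. c \<in> H \<Longrightarrow> c' \<in> H \<Longrightarrow> F c \<noteq> G c'"
    and dif: "\<And>c1 c2 c3. c1 \<in> H \<Longrightarrow> c2 \<in> H \<Longrightarrow> c3 \<in> H \<Longrightarrow> G c1 = G c2 \<Longrightarrow> F c2 = F c3 \<Longrightarrow>
      \<exists>c \<in> H. F c = F c1 \<and> G c = G c3"
    and c: "c \<in> H" and "difunctional_closure H F G (G c) w"
  shows "difunctional_closure H F G (F c) w"
  using assms(4)
proof cases
  case refl
  then show ?thesis using c by (intro difunctional_closure.FG[of c]) auto
next
  case (FG c1)
  then show ?thesis using disj c by metis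
next
  case (GF c1)
  then show ?thesis using c by (intro difunctional_closure.FF[of c _ c1]) auto
next
  case (FF c1 c2)
  then show ?thesis using disj c by metis
next
  case (GG c1 c2)
  then obtain d where "d \<in> H" "F d = F c" "G d = G c2" using dif[of c c1 c2] c by metis
  then show ?thesis using GG by (intro difunctional_closure.FG[of d]) auto
qed

text \<open>Every generator other than \<open>refl\<close> is one step between the summands or two
  such steps, so it suffices to prepend single steps. Steps in the opposite direction follow by
  exchanging \<open>F\<close> and \<open>G\<close>, with the zigzag read backwards in
  \<open>dif'\<close>.\<close>

lemma difunctional_closure_trans:
  assumes disj: "\<And>c c'. c \<in> H \<Longrightarrow> c' \<in> H \<Longrightarrow> F c \<noteq> G c'"
    and dif: "\<And>c1 c2 c3. c1 \<in> H \<Longrightarrow> c2 \<in> H \<Longrightarrow> c3 \<in> H \<Longrightarrow> G c1 = G c2 \<Longrightarrow> F c2 = F c3 \<Longrightarrow>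
      \<exists>c \<in> H. F c = F c1 \<and> G c = G c3"
    and uv: "difunctional_closure H F G u v" and vw: "difunctional_closure H F G v w"
  shows "difunctional_closure H F G u w"
proof -
  have dif': "\<exists>c \<in> H. G c = G c1 \<and> F c = F c3"
    if "c1 \<in> H" "c2 \<in> H" "c3 \<in> H" "F c1 = F c2" "G c2 = G c3" for c1 c2 c3
    using dif[of c3 c2 c1] that by metis
  have stepF: "difunctional_closure H F G (F c) w" if "c \<in> H" "difunctional_closure H F G (G c) w" for c w
    by (rule difunctional_closure_FG_trans[OF disj dif that])
  have stepG: "difunctional_closure H F G (G c) w" if "c \<in> H" "difunctional_closure H F G (F c) w" for c w
    by (rule difunctional_closure_swap, rule difunctional_closure_FG_trans)
      (use disj dif' that difunctional_closure_swap in metis)+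
  show ?thesis
    using uv
  proof cases
    case refl
    then show ?thesis using vw by simp
  next
    case (FG c)
    then show ?thesis using stepF vw by simp
  next
    case (GF c)
    then show ?thesis using stepG vw by simp
  next
    case (FF c c')
    then show ?thesis using stepF[of c] stepG[of c'] vw by simp
  next
    case (GG c c')
    then show ?thesis using stepG[of c] stepF[of c'] vw by simp
  qed
qed

section \<open>The quotient of a sum by the relation generated by a Mal'cev span\<close>

context category
begin

text \<open>The closure is formed separately at each stage \<open>X\<close>, hence is not yet a
  subobject of \<open>S x S\<close>. The relation \<open>e1\<close>, \<open>e2\<close> built in
  \<open>malcev_quotient\<close> consists of the pairs that satisfy it on a cover.\<close>

abbreviation span_rel :: "'a \<Rightarrow> 'a \<Rightarrow> 'a \<Rightarrow> 'a \<Rightarrow> 'o \<Rightarrow> 'a \<Rightarrow> 'a \<Rightarrow> bool"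
  where "span_rel f g i j X \<equiv>
    difunctional_closure (Hom C X (Dom C f)) (\<lambda>c. i \<cdot> (f \<cdot> c)) (\<lambda>c. j \<cdot> (g \<cdot> c))"

lemma span_rel_comp:
  assumes rel: "span_rel f g i j X u v" and uv: "u \<in> Hom C X S" "v \<in> Hom C X S"
    and fg: "f \<in> Arr C" "g \<in> Arr C" "Dom C g = Dom C f" "i \<in> Hom C (Cod C f) S" "j \<in> Hom C (Cod C g) S"
    and x: "x \<in> Hom C Y X"
  shows "span_rel f g i j Y (u \<cdot> x) (v \<cdot> x)"
proof -
  have F: "c \<cdot> x \<in> Hom C Y (Dom C f)" "i \<cdot> (f \<cdot> (c \<cdot> x)) = (i \<cdot> (f \<cdot> c)) \<cdot> x"
    "j \<cdot> (g \<cdot> (c \<cdot> x)) = (j \<cdot> (g \<cdot> c)) \<cdot> x"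
    if "c \<in> Hom C X (Dom C f)" for c
    using that fg x by simp_all
  show ?thesis
    using rel
  proof cases
    case refl
    then show ?thesis by (intro difunctional_closure.refl) simp
  next
    case (FG c)
    then show ?thesis using F[of c] by (intro difunctional_closure.FG[of "c \<cdot> x"]) simp_all
  next
    case (GF c)
    then show ?thesis using F[of c] by (intro difunctional_closure.GF[of "c \<cdot> x"]) simp_all
  next
    case (FF c c')
    then show ?thesis using F[of c] F[of c'] by (intro difunctional_closure.FF[of "c \<cdot> x" _ "c' \<cdot> x"]) simp_all
  next
    case (GG c c')
    then show ?thesis using F[of c] F[of c'] by (intro difunctional_closure.GG[of "c \<cdot> x" _ "c' \<cdot> x"]) simp_all
  qed
qed

context
  assumes pt: "pretopos C"
begin

text \<open>The last clause is the description of equality in the quotient on which both the pushout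
  and the pullback property rest.\<close>

lemma malcev_quotient:
  assumes mal: "malcev_span C f g"
  obtains S i j q where
    "is_coproduct C {0, 1 :: nat} (\<lambda>n. if n = 0 then Cod C f else Cod C g) S (\<lambda>n. if n = 0 then i else j)"
    "monic C i" "monic C j"
    "\<And>X u v. u \<in> Hom C X (Cod C f) \<Longrightarrow> v \<in> Hom C X (Cod C g) \<Longrightarrow> i \<cdot> u = j \<cdot> v \<Longrightarrow> is_initial C X"
    "regular_epi C q" "Dom C q = S" "q \<cdot> (i \<cdot> f) = q \<cdot> (j \<cdot> g)"
    "\<And>X u v. u \<in> Hom C X S \<Longrightarrow> v \<in> Hom C X S \<Longrightarrow> q \<cdot> u = q \<cdot> v \<Longrightarrow>
      covers X (\<lambda>x. span_rel f g i j (Dom C x) (u \<cdot> x) (v \<cdot> x))"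
proof -
  note fc = pretopos_finitely_complete[OF pt]
  let ?\<Gamma> = "Dom C f"
  have jm: "jointly_monic C f g" using mal by (simp add: malcev_span_def)
  note fg [simp] = jointly_monic_span[OF jm]
  obtain S i j where cop: "is_coproduct C {0, 1 :: nat} (\<lambda>n. if n = 0 then Cod C f else Cod C g) S
      (\<lambda>n. if n = 0 then i else j)" and mi: "monic C i" and mj: "monic C j"
    and disj: "\<And>X u v. u \<in> Hom C X (Cod C f) \<Longrightarrow> v \<in> Hom C X (Cod C g) \<Longrightarrow> i \<cdot> u = j \<cdot> v \<Longrightarrow> is_initial C X"
    using pretopos_sum[OF pt, of "Cod C f" "Cod C g"] by (metis Cod_in_Obj fg(1,2))
  have i [simp]: "i \<in> Arr C" "Dom C i = Cod C f" "Cod C i = S"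
    using is_coproductD(3-5)[OF cop, of 0] by simp_all
  have j [simp]: "j \<in> Arr C" "Dom C j = Cod C g" "Cod C j = S"
    using is_coproductD(3-5)[OF cop, of 1] by simp_all
  have S: "S \<in> Obj C" using is_coproductD(1)[OF cop] .
  obtain p3 q3 where pq3: "is_pullback C p3 q3 g g" using pullback_exists[OF fc, of g g] by auto
  obtain p4 q4 where pq4: "is_pullback C p4 q4 f f" using pullback_exists[OF fc, of f f] by auto
  note [simp] = is_pullback_comm(1,2,5-7)[OF pq3] is_pullback_comm(1,2,5-7)[OF pq4]
  \<comment> \<open>The five pieces correspond in order to \<open>refl\<close>, \<open>FG\<close>,
    \<open>GF\<close>, \<open>FF\<close> and \<open>GG\<close>. Pairs with equal \<open>g\<close>
    are parametrized by the kernel pair \<open>p3\<close>, \<open>q3\<close>, pairs with equal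
    \<open>f\<close> by \<open>p4\<close>, \<open>q4\<close>.\<close>
  define I where "I = {0,1,2,3,4::nat}"
  define W where "W = (!) [S, ?\<Gamma>, ?\<Gamma>, Dom C p3, Dom C p4]"
  define d0 where "d0 = (!) [Id C S, i \<cdot> f, j \<cdot> g, i \<cdot> (f \<cdot> p3), j \<cdot> (g \<cdot> p4)]"
  define d1 where "d1 = (!) [Id C S, j \<cdot> g, i \<cdot> f, i \<cdot> (f \<cdot> q3), j \<cdot> (g \<cdot> q4)]"
  have d: "d0 k \<in> Hom C (W k) S" "d1 k \<in> Hom C (W k) S" if "k \<in> I" for k
    using that S unfolding I_def by (auto simp: d0_def d1_def W_def)
  have "finite I" by (simp add: I_def)
  then obtain e1 e2 where jme: "jointly_monic C e1 e2" and e: "Cod C e1 = S" "Cod C e2 = S"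
    and gen: "\<And>k. k \<in> I \<Longrightarrow> \<exists>w \<in> Hom C (W k) (Dom C e1). e1 \<cdot> w = d0 k \<and> e2 \<cdot> w = d1 k"
    and cov: "\<And>X w. w \<in> Hom C X (Dom C e1) \<Longrightarrow> covers X (\<lambda>x. \<exists>k \<in> I. \<exists>c \<in> Hom C (Dom C x) (W k).
      e1 \<cdot> (w \<cdot> x) = d0 k \<cdot> c \<and> e2 \<cdot> (w \<cdot> x) = d1 k \<cdot> c)"
    by (rule relation_image[OF pt _ S d]) blast+
  note [simp] = jointly_monic_span[OF jme] e
  let ?E = "Dom C e1"
  have gen': "\<exists>w \<in> Hom C X ?E. e1 \<cdot> w = d0 k \<cdot> c \<and> e2 \<cdot> w = d1 k \<cdot> c"
    if k: "k \<in> I" and c: "c \<in> Hom C X (W k)" for k c X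
  proof -
    obtain w where w: "w \<in> Arr C" "Dom C w = W k" "Cod C w = ?E" "e1 \<cdot> w = d0 k" "e2 \<cdot> w = d1 k"
      using gen[OF k] by auto
    then show ?thesis
      using c Comp_extend[OF w(4), of c] Comp_extend[OF w(5), of c] by (intro bexI[of _ "w \<cdot> c"]) simp_all
  qed
  \<comment> \<open>Elements related at a stage lie in the image without passing to a cover. The
    converse \<open>covE\<close> holds only locally.\<close>
  have relE: "\<exists>w \<in> Hom C X ?E. e1 \<cdot> w = u \<and> e2 \<cdot> w = v"
    if u: "u \<in> Hom C X S" and v: "v \<in> Hom C X S" and rel: "span_rel f g i j X u v" for X u v
    using rel
  proof cases
    case refl
    then show ?thesis using gen'[of 0 u X] u by (auto simp: I_def W_def d0_def d1_def)
  next
    case (FG c)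
    then show ?thesis using gen'[of 1 c X] by (simp add: I_def W_def d0_def d1_def)
  next
    case (GF c)
    then show ?thesis using gen'[of 2 c X] by (simp add: I_def W_def d0_def d1_def)
  next
    case (FF c c')
    \<comment> \<open>The closure compares elements of \<open>S\<close>; cancelling the monic
      injection gives a pair in the kernel pair of \<open>g\<close>.\<close>
    have "g \<cdot> c = g \<cdot> c'" by (rule monicD[OF mj, of _ X]) (use FF in simp_all)
    then obtain w where "w \<in> Arr C" "Dom C w = X" "Cod C w = Dom C p3" "p3 \<cdot> w = c" "q3 \<cdot> w = c'"
      using is_pullback_lift[OF pq3, of c X c'] FF by auto
    then show ?thesis using gen'[of 3 w X] FF by (simp add: I_def W_def d0_def d1_def)
  next
    case (GG c c')
    have "f \<cdot> c = f \<cdot> c'" by (rule monicD[OF mi, of _ X]) (use GG in simp_all)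
    then obtain w where "w \<in> Arr C" "Dom C w = X" "Cod C w = Dom C p4" "p4 \<cdot> w = c" "q4 \<cdot> w = c'"
      using is_pullback_lift[OF pq4, of c X c'] GG by auto
    then show ?thesis using gen'[of 4 w X] GG by (simp add: I_def W_def d0_def d1_def)
  qed
  have covE: "covers X (\<lambda>x. span_rel f g i j (Dom C x) (e1 \<cdot> (w \<cdot> x)) (e2 \<cdot> (w \<cdot> x)))"
    if w: "w \<in> Hom C X ?E" for X w
  proof (rule covers_mono[OF cov[OF w]])
    fix Y y assume y: "y \<in> Hom C Y X" and "\<exists>k\<in>I. \<exists>c\<in>Hom C (Dom C y) (W k).
      e1 \<cdot> (w \<cdot> y) = d0 k \<cdot> c \<and> e2 \<cdot> (w \<cdot> y) = d1 k \<cdot> c"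
    then obtain k c where k: "k \<in> I" and c: "c \<in> Hom C Y (W k)"
      and eq: "e1 \<cdot> (w \<cdot> y) = d0 k \<cdot> c" "e2 \<cdot> (w \<cdot> y) = d1 k \<cdot> c" by auto
    have [simp]: "Dom C y = Y" using y by simp
    consider "k = 0" | "k = 1" | "k = 2" | "k = 3" | "k = 4" using k unfolding I_def by blast
    then show "span_rel f g i j (Dom C y) (e1 \<cdot> (w \<cdot> y)) (e2 \<cdot> (w \<cdot> y))"
    proof cases
      case 1
      then show ?thesis using eq by (intro difunctional_closure.refl) (simp add: d0_def d1_def)
    next
      case 2
      then show ?thesis
        using eq c by (intro difunctional_closure.FG[of c]) (simp_all add: W_def d0_def d1_def)
    next
      case 3
      then show ?thesis
        using eq c by (intro difunctional_closure.GF[of c]) (simp_all add: W_def d0_def d1_def)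
    next
      case 4
      then have c3: "c \<in> Arr C" "Dom C c = Y" "Cod C c = Dom C p3" using c by (simp_all add: W_def)
      then show ?thesis
        using eq 4 Comp_extend[OF is_pullback_comm(9)[OF pq3], of c]
        by (intro difunctional_closure.FF[of "p3 \<cdot> c" _ "q3 \<cdot> c"]) (simp_all add: d0_def d1_def)
    next
      case 5
      then have c4: "c \<in> Arr C" "Dom C c = Y" "Cod C c = Dom C p4" using c by (simp_all add: W_def)
      then show ?thesis
        using eq 5 Comp_extend[OF is_pullback_comm(9)[OF pq4], of c]
        by (intro difunctional_closure.GG[of "p4 \<cdot> c" _ "q4 \<cdot> c"]) (simp_all add: d0_def d1_def)
    qed
  qed
  have rel_trans: "\<exists>w' \<in> Hom C X ?E. e1 \<cdot> w' = u \<and> e2 \<cdot> w' = w"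
    if uvw: "u \<in> Hom C X S" "v \<in> Hom C X S" "w \<in> Hom C X S"
      and uv: "span_rel f g i j X u v" and vw: "span_rel f g i j X v w" for X u v w
  proof (cases "is_initial C X")
    case True
    have "?E \<in> Obj C" by simp
    then obtain w' where w': "w' \<in> Arr C" "Dom C w' = X" "Cod C w' = ?E"
      by (rule is_initial_lift[OF True])
    have "e1 \<cdot> w' = u" "e2 \<cdot> w' = w" by (rule is_initial_eqI[OF True, of _ S], use w' uvw in simp_all)+
    then show ?thesis using w' by (intro bexI[of _ w']) simp_all
  next
    case False
    have "span_rel f g i j X u w"
    proof (rule difunctional_closure_trans[OF _ _ uv vw])
      fix c c' assume "c \<in> Hom C X ?\<Gamma>" "c' \<in> Hom C X ?\<Gamma>"
      then show "i \<cdot> (f \<cdot> c) \<noteq> j \<cdot> (g \<cdot> c')" using disj[of "f \<cdot> c" X "g \<cdot> c'"] False by auto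
    next
      fix c1 c2 c3 assume c: "c1 \<in> Hom C X ?\<Gamma>" "c2 \<in> Hom C X ?\<Gamma>" "c3 \<in> Hom C X ?\<Gamma>"
        "j \<cdot> (g \<cdot> c1) = j \<cdot> (g \<cdot> c2)" "i \<cdot> (f \<cdot> c2) = i \<cdot> (f \<cdot> c3)"
      have "g \<cdot> c1 = g \<cdot> c2" by (rule monicD[OF mj, of _ X]) (use c in simp_all)
      moreover have "f \<cdot> c2 = f \<cdot> c3" by (rule monicD[OF mi, of _ X]) (use c in simp_all)
      moreover have "X \<in> Obj C" using c(1) Dom_in_Obj[of c1] by simp
      ultimately have "zigzag C f g X c1 c2 c3" using c(1-3) unfolding zigzag_def by simp
      then obtain c where "c \<in> Arr C" "Dom C c = X" "Cod C c = ?\<Gamma>" "f \<cdot> c = f \<cdot> c1" "g \<cdot> c = g \<cdot> c3"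
        by (rule malcev_spanE[OF mal])
      then show "\<exists>c\<in>Hom C X ?\<Gamma>. i \<cdot> (f \<cdot> c) = i \<cdot> (f \<cdot> c1) \<and> j \<cdot> (g \<cdot> c) = j \<cdot> (g \<cdot> c3)"
        by (intro bexI[of _ c]) simp_all
    qed
    then show ?thesis using relE uvw by blast
  qed
  have legs: "i \<in> Hom C (Cod C f) S" "j \<in> Hom C (Cod C g) S"
    by simp_all
  have eqr: "is_equivalence_relation C e1 e2"
  proof -
    obtain d where d: "d \<in> Hom C S ?E" "e1 \<cdot> d = Id C S" "e2 \<cdot> d = Id C S"
      using gen[of 0] by (auto simp: I_def W_def d0_def d1_def)
    \<comment> \<open>The covering description is applied to the universal element
      \<open>Id C ?E\<close>, and the reversed local relations are glued.\<close>
    have "\<exists>w \<in> Hom C ?E ?E. e1 \<cdot> w = e2 \<and> e2 \<cdot> w = e1"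
    proof (rule covers_lift[OF covE[of "Id C ?E" ?E] jme])
      fix Y y assume y: "y \<in> Hom C Y ?E"
        and "span_rel f g i j (Dom C y) (e1 \<cdot> (Id C ?E \<cdot> y)) (e2 \<cdot> (Id C ?E \<cdot> y))"
      then have "span_rel f g i j Y (e2 \<cdot> y) (e1 \<cdot> y)" by (auto intro: difunctional_closure_sym)
      then show "\<exists>w\<in>Hom C Y ?E. e1 \<cdot> w = e2 \<cdot> y \<and> e2 \<cdot> w = e1 \<cdot> y"
        using relE[of "e2 \<cdot> y" Y "e1 \<cdot> y"] y by simp
    qed simp_all
    moreover obtain p q where pq: "is_pullback C p q e2 e1" using pullback_exists[OF fc, of e2 e1] by auto
    note pqD [simp] = is_pullback_comm(1,2,5-7)[OF pq]
    \<comment> \<open>Two nested covers are needed: one on which \<open>p\<close> is described by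
      generators and, over each of its members, one for \<open>q\<close>. The first relation is
      restricted along the second cover before composing.\<close>
    have "\<exists>t \<in> Hom C (Dom C p) ?E. e1 \<cdot> t = e1 \<cdot> p \<and> e2 \<cdot> t = e2 \<cdot> q"
    proof (rule covers_lift[OF covE[of p "Dom C p"] jme])
      fix Y y assume "y \<in> Hom C Y (Dom C p)"
        and rel: "span_rel f g i j (Dom C y) (e1 \<cdot> (p \<cdot> y)) (e2 \<cdot> (p \<cdot> y))"
      then have y [simp]: "y \<in> Arr C" "Dom C y = Y" "Cod C y = Dom C p" by simp_all
      have mid: "e2 \<cdot> (p \<cdot> y) = e1 \<cdot> (q \<cdot> y)"
        using Comp_extend[OF is_pullback_comm(9)[OF pq], of y] by simp
      show "\<exists>w\<in>Hom C Y ?E. e1 \<cdot> w = (e1 \<cdot> p) \<cdot> y \<and> e2 \<cdot> w = (e2 \<cdot> q) \<cdot> y"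
      proof (rule covers_lift[OF covE[of "q \<cdot> y" Y] jme])
        fix Z z assume "z \<in> Hom C Z Y"
          and rel': "span_rel f g i j (Dom C z) (e1 \<cdot> ((q \<cdot> y) \<cdot> z)) (e2 \<cdot> ((q \<cdot> y) \<cdot> z))"
        then have z [simp]: "z \<in> Arr C" "Dom C z = Z" "Cod C z = Y" by simp_all
        have "span_rel f g i j Z ((e1 \<cdot> (p \<cdot> y)) \<cdot> z) ((e2 \<cdot> (p \<cdot> y)) \<cdot> z)"
          by (rule span_rel_comp[OF _ _ _ fg legs, of Y]) (use rel in simp_all)
        then have "span_rel f g i j Z (e1 \<cdot> (p \<cdot> (y \<cdot> z))) (e1 \<cdot> (q \<cdot> (y \<cdot> z)))"
          unfolding mid by simp
        moreover have "span_rel f g i j Z (e1 \<cdot> (q \<cdot> (y \<cdot> z))) (e2 \<cdot> (q \<cdot> (y \<cdot> z)))"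
          using rel' by simp
        ultimately show "\<exists>w\<in>Hom C Z ?E. e1 \<cdot> w = ((e1 \<cdot> p) \<cdot> y) \<cdot> z \<and> e2 \<cdot> w = ((e2 \<cdot> q) \<cdot> y) \<cdot> z"
          using rel_trans[of "e1 \<cdot> (p \<cdot> (y \<cdot> z))" Z "e1 \<cdot> (q \<cdot> (y \<cdot> z))" "e2 \<cdot> (q \<cdot> (y \<cdot> z))"] by simp
      qed simp_all
    qed simp_all
    then obtain t where "t \<in> Hom C (Dom C p) ?E" "e1 \<cdot> t = e1 \<cdot> p" "e2 \<cdot> t = e2 \<cdot> q" by blast
    ultimately show ?thesis
      unfolding is_equivalence_relation_def e using jme d pq e by blast
  qed
  obtain q where q: "is_coequalizer C e1 e2 q" "is_pullback C e1 e2 q q"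
    by (rule pretopos_quotient[OF pt eqr])
  note qD = is_coequalizerD[OF q(1)]
  have qS [simp]: "q \<in> Arr C" "Dom C q = S" using qD by simp_all
  show ?thesis
  proof (rule that[OF cop mi mj disj])
    show "regular_epi C q" using q(1) unfolding regular_epi_def by blast
    show "Dom C q = S" by simp
    obtain w where w: "w \<in> Arr C" "Dom C w = ?\<Gamma>" "Cod C w = ?E" "e1 \<cdot> w = i \<cdot> f" "e2 \<cdot> w = j \<cdot> g"
      using gen[of 1] by (auto simp: I_def W_def d0_def d1_def)
    then show "q \<cdot> (i \<cdot> f) = q \<cdot> (j \<cdot> g)" using Comp_extend[OF qD(7), of w] by simp
    fix X u v assume uv: "u \<in> Hom C X S" "v \<in> Hom C X S" "q \<cdot> u = q \<cdot> v"
    then obtain w where w: "w \<in> Arr C" "Dom C w = X" "Cod C w = ?E" "e1 \<cdot> w = u" "e2 \<cdot> w = v"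
      using is_pullback_lift[OF q(2), of u X v] by auto
    then have "covers X (\<lambda>x. span_rel f g i j (Dom C x) (e1 \<cdot> (w \<cdot> x)) (e2 \<cdot> (w \<cdot> x)))"
      by (intro covE) simp
    then show "covers X (\<lambda>x. span_rel f g i j (Dom C x) (u \<cdot> x) (v \<cdot> x))"
    proof (rule covers_mono)
      fix Y y assume "y \<in> Hom C Y X"
        and "span_rel f g i j (Dom C y) (e1 \<cdot> (w \<cdot> y)) (e2 \<cdot> (w \<cdot> y))"
      then show "span_rel f g i j (Dom C y) (u \<cdot> y) (v \<cdot> y)"
        using w Comp_extend[OF w(4), of y] Comp_extend[OF w(5), of y] by simp
    qed
  qed
qed

end

section \<open>Pushouts of Mal'cev spans in a pretopos\<close>

text \<open>Allows \<open>x\<close> to be an identity in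
  \<open>quotient_pullback_pushout\<close>.\<close>

lemma is_pullback_Id:
  assumes [simp]: "h \<in> Arr C"
  shows "is_pullback C (Id C (Dom C h)) h h (Id C (Cod C h))"
proof (rule is_pullbackI)
  show "comm_square C (Id C (Dom C h)) h h (Id C (Cod C h))" by (simp add: comm_square_def)
  fix X u v assume "u \<in> Hom C X (Dom C h)" "v \<in> Hom C X (Dom C (Id C (Cod C h)))" "h \<cdot> u = Id C (Cod C h) \<cdot> v"
  then show "\<exists>w\<in>Hom C X (Dom C (Id C (Dom C h))). Id C (Dom C h) \<cdot> w = u \<and> h \<cdot> w = v"
    by (intro bexI[of _ u]) simp_all
next
  fix X w w' assume "w \<in> Hom C X (Dom C (Id C (Dom C h)))" "w' \<in> Hom C X (Dom C (Id C (Dom C h)))"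
    "Id C (Dom C h) \<cdot> w = Id C (Dom C h) \<cdot> w'"
  then show "w = w'" by simp
qed

text \<open>The arrow \<open>w\<close> can be cancelled by its retraction \<open>w'\<close>, so
  \<open>w \<cdot> h\<close> and \<open>w \<cdot> k\<close> impose the same condition as
  \<open>h\<close> and \<open>k\<close>. Used to replace one pushout of a span by another.\<close>

lemma is_pullback_split_mono_comp:
  assumes pb: "is_pullback C p q h k" and w: "w \<in> Arr C" "Dom C w = Cod C h"
    and w': "w' \<in> Arr C" "Dom C w' = Cod C w" "w' \<cdot> w = Id C (Cod C h)"
  shows "is_pullback C p q (w \<cdot> h) (w \<cdot> k)"
proof (rule is_pullbackI)
  note [simp] = is_pullback_comm(1-8)[OF pb] w w'(1,2)
  show "comm_square C p q (w \<cdot> h) (w \<cdot> k)"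
    using is_pullback_comm(9)[OF pb] by (simp add: comm_square_def)
  fix X
  { fix u v assume uv: "u \<in> Hom C X (Dom C (w \<cdot> h))" "v \<in> Hom C X (Dom C (w \<cdot> k))"
      "(w \<cdot> h) \<cdot> u = (w \<cdot> k) \<cdot> v"
    then have uv' [simp]: "u \<in> Arr C" "v \<in> Arr C" "Dom C u = X" "Dom C v = X" "Cod C u = Dom C h"
      "Cod C v = Dom C k" and eq: "w \<cdot> (h \<cdot> u) = w \<cdot> (k \<cdot> v)"
      by simp_all
    have "h \<cdot> u = w' \<cdot> (w \<cdot> (h \<cdot> u))" using Comp_extend[OF w'(3), of "h \<cdot> u"] by simp
    also have "\<dots> = k \<cdot> v" unfolding eq using Comp_extend[OF w'(3), of "k \<cdot> v"] by simp
    finally obtain z where "z \<in> Arr C" "Dom C z = X" "Cod C z = Dom C p" "p \<cdot> z = u" "q \<cdot> z = v"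
      by (rule is_pullback_lift[OF pb, of u X v, rotated 2]) simp_all
    then show "\<exists>z\<in>Hom C X (Dom C p). p \<cdot> z = u \<and> q \<cdot> z = v" by (intro bexI[of _ z]) simp_all }
  { fix z z' assume "z \<in> Hom C X (Dom C p)" "z' \<in> Hom C X (Dom C p)" "p \<cdot> z = p \<cdot> z'" "q \<cdot> z = q \<cdot> z'"
    then show "z = z'" by (rule is_pullback_eqI[OF pb]) }
qed

lemma is_pushout_unique:
  assumes po: "is_pushout C f g h k" and po': "is_pushout C f g h' k'"
  obtains w w' where "w \<in> Hom C (Cod C h') (Cod C h)" "w' \<in> Hom C (Cod C h) (Cod C h')"
    "w \<cdot> h' = h" "w \<cdot> k' = k" "w' \<cdot> w = Id C (Cod C h')"
proof -
  note [simp] = is_pushout_comm(1-8)[OF po] is_pushout_comm(3,4,6-8)[OF po']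
  obtain w where w: "w \<in> Arr C" "Dom C w = Cod C h'" "Cod C w = Cod C h" "w \<cdot> h' = h" "w \<cdot> k' = k"
    by (rule is_pushout_lift[OF po', of h "Cod C h" k]) (use is_pushout_comm(9)[OF po] in simp_all)
  obtain w' where w': "w' \<in> Arr C" "Dom C w' = Cod C h" "Cod C w' = Cod C h'" "w' \<cdot> h = h'" "w' \<cdot> k = k'"
    by (rule is_pushout_lift[OF po, of h' "Cod C h'" k']) (use is_pushout_comm(9)[OF po'] in simp_all)
  have "w' \<cdot> w = Id C (Cod C h')"
    by (rule is_pushout_eqI[OF po', of _ "Cod C h'"]) (use w w' in simp_all)
  then show ?thesis using that w w' by simp
qed

text \<open>An element of the pulled back vertex \<open>Dom C e\<close> amounts to an element
  \<open>c\<close> of the span and an element \<open>s\<close> of the pulled back sum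
  \<open>Dom C \<pi>\<close> lying over \<open>i \<cdot> (f \<cdot> c)\<close>. It is applied to
  either leg, since \<open>q \<cdot> (i \<cdot> f)\<close> and
  \<open>q \<cdot> (j \<cdot> g)\<close> agree.\<close>

lemma is_pullback_trace:
  assumes pq: "is_pullback C \<pi> q' q x" and cl: "is_pullback C e l (q \<cdot> (i \<cdot> f)) x"
    and f: "f \<in> Arr C" "i \<in> Arr C" "Cod C f = Dom C i" "Cod C i = Dom C q"
    and a: "a \<in> Arr C" "Cod C a = Dom C i" and i': "i' \<in> Hom C (Dom C a) (Dom C \<pi>)" "\<pi> \<cdot> i' = i \<cdot> a"
    and f': "f' \<in> Hom C (Dom C e) (Dom C a)" "a \<cdot> f' = f \<cdot> e" "q' \<cdot> (i' \<cdot> f') = l"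
  shows "\<pi> \<cdot> (i' \<cdot> f') = i \<cdot> (f \<cdot> e)"
    and "c \<in> Hom C Y (Dom C f) \<Longrightarrow> s \<in> Hom C Y (Dom C \<pi>) \<Longrightarrow> \<pi> \<cdot> s = i \<cdot> (f \<cdot> c) \<Longrightarrow>
      \<exists>c' \<in> Hom C Y (Dom C e). e \<cdot> c' = c \<and> l \<cdot> c' = q' \<cdot> s \<and> i' \<cdot> (f' \<cdot> c') = s"
proof -
  note [simp] = is_pullback_comm(1-8)[OF pq] f a
  have [simp]: "i' \<in> Arr C" "Dom C i' = Dom C a" "Cod C i' = Dom C \<pi>"
    "f' \<in> Arr C" "Dom C f' = Dom C e" "Cod C f' = Dom C a" using i' f' by simp_all
  have [simp]: "e \<in> Arr C" "l \<in> Arr C" "Dom C l = Dom C e" "Cod C e = Dom C f" "Cod C l = Dom C x"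
    using is_pullback_comm[OF cl] by simp_all
  show *: "\<pi> \<cdot> (i' \<cdot> f') = i \<cdot> (f \<cdot> e)"
    using Comp_extend[OF i'(2), of f'] f'(2) by simp
  assume c: "c \<in> Hom C Y (Dom C f)" and s: "s \<in> Hom C Y (Dom C \<pi>)" and eq: "\<pi> \<cdot> s = i \<cdot> (f \<cdot> c)"
  have "(q \<cdot> (i \<cdot> f)) \<cdot> c = x \<cdot> (q' \<cdot> s)"
    using Comp_extend[OF is_pullback_comm(9)[OF pq], of s] c s eq by simp
  then obtain c' where c': "c' \<in> Arr C" "Dom C c' = Y" "Cod C c' = Dom C e" "e \<cdot> c' = c" "l \<cdot> c' = q' \<cdot> s"
    by (rule is_pullback_lift[OF cl, of c Y "q' \<cdot> s", rotated 2]) (use c s in simp_all)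
  have "i' \<cdot> (f' \<cdot> c') = s"
    by (rule is_pullback_eqI[OF pq, of _ Y])
      (use c' s eq Comp_extend[OF *, of c'] Comp_extend[OF f'(3), of c'] in simp_all)
  then show "\<exists>c' \<in> Hom C Y (Dom C e). e \<cdot> c' = c \<and> l \<cdot> c' = q' \<cdot> s \<and> i' \<cdot> (f' \<cdot> c') = s"
    using c' by (intro bexI[of _ c']) simp_all
qed

context
  assumes pt: "pretopos C"
begin

text \<open>A cocone \<open>u\<close>, \<open>v\<close> on the pulled back span is a single arrow
  \<open>t\<close> out of the pulled back sum. It factors through \<open>q'\<close> once it
  coequalizes the kernel pair of \<open>q'\<close>, and this equation is checked on the cover given
  by \<open>cov\<close>.\<close>

lemma quotient_pullback_pushout:
  assumes span: "f \<in> Arr C" "g \<in> Arr C" "Dom C g = Dom C f"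
    and cop: "is_coproduct C {0, 1 :: nat} (\<lambda>n. if n = 0 then Cod C f else Cod C g) S
      (\<lambda>n. if n = 0 then i else j)"
    and q: "regular_epi C q" "Dom C q = S" "q \<cdot> (i \<cdot> f) = q \<cdot> (j \<cdot> g)"
    and cov: "\<And>X u v. u \<in> Hom C X S \<Longrightarrow> v \<in> Hom C X S \<Longrightarrow> q \<cdot> u = q \<cdot> v \<Longrightarrow>
      covers X (\<lambda>x. span_rel f g i j (Dom C x) (u \<cdot> x) (v \<cdot> x))"
    and a: "is_pullback C a h' (q \<cdot> i) x" and b: "is_pullback C b k' (q \<cdot> j) x"
    and e: "is_pullback C e l (q \<cdot> (i \<cdot> f)) x"
    and f': "f' \<in> Hom C (Dom C e) (Dom C a)" "a \<cdot> f' = f \<cdot> e" "h' \<cdot> f' = l"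
    and g': "g' \<in> Hom C (Dom C e) (Dom C b)" "b \<cdot> g' = g \<cdot> e" "k' \<cdot> g' = l"
  shows "is_pushout C f' g' h' k'"
proof -
  note fc = pretopos_finitely_complete[OF pt]
  note [simp] = span q(2) regular_epi_Arr[OF q(1)]
  have [simp]: "i \<in> Arr C" "Dom C i = Cod C f" "Cod C i = S" "j \<in> Arr C" "Dom C j = Cod C g" "Cod C j = S"
    using is_coproductD(3-5)[OF cop, of 0] is_coproductD(3-5)[OF cop, of 1] by simp_all
  have [simp]: "a \<in> Arr C" "h' \<in> Arr C" "Dom C h' = Dom C a" "Cod C a = Cod C f" "Cod C h' = Dom C x"
    "x \<in> Arr C" "Cod C x = Cod C q"
    using is_pullback_comm[OF a] by simp_all
  have [simp]: "b \<in> Arr C" "k' \<in> Arr C" "Dom C k' = Dom C b" "Cod C b = Cod C g" "Cod C k' = Dom C x"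
    using is_pullback_comm[OF b] by simp_all
  have [simp]: "e \<in> Arr C" "l \<in> Arr C" "Dom C l = Dom C e" "Cod C e = Dom C f" "Cod C l = Dom C x"
    using is_pullback_comm[OF e] by simp_all
  have [simp]: "f' \<in> Arr C" "Dom C f' = Dom C e" "Cod C f' = Dom C a"
    "g' \<in> Arr C" "Dom C g' = Dom C e" "Cod C g' = Dom C b" using f' g' by simp_all
  obtain \<pi> q' where pq: "is_pullback C \<pi> q' q x" using pullback_exists[OF fc, of q x] by auto
  note [simp] = is_pullback_comm(1,2,5,7)[OF pq]
  have [simp]: "Cod C \<pi> = S" using is_pullback_comm(6)[OF pq] by simp
  have q': "regular_epi C q'" using pretopos_regular_epi_pullback[OF pt q(1) pq] .
  obtain i' where i': "i' \<in> Arr C" "Dom C i' = Dom C a" "Cod C i' = Dom C \<pi>" "\<pi> \<cdot> i' = i \<cdot> a" "q' \<cdot> i' = h'"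
    by (rule is_pullback_lift[OF pq, of "i \<cdot> a" "Dom C a" h']) (use is_pullback_comm(9)[OF a] in simp_all)
  obtain j' where j': "j' \<in> Arr C" "Dom C j' = Dom C b" "Cod C j' = Dom C \<pi>" "\<pi> \<cdot> j' = j \<cdot> b" "q' \<cdot> j' = k'"
    by (rule is_pullback_lift[OF pq, of "j \<cdot> b" "Dom C b" k']) (use is_pullback_comm(9)[OF b] in simp_all)
  note [simp] = i'(1-3) j'(1-3)
  let ?inc' = "\<lambda>n. if n = (0::nat) then i' else j'"
  \<comment> \<open>By pasting, \<open>i'\<close> and \<open>j'\<close> are the pullbacks of the
    injections along \<open>\<pi>\<close>, so stability makes them injections of a
    coproduct.\<close>
  have pbi: "is_pullback C a i' i \<pi>" by (rule is_pullback_left[OF a pq]) (use i' in simp_all)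
  have pbj: "is_pullback C b j' j \<pi>" by (rule is_pullback_left[OF b pq]) (use j' in simp_all)
  have cop': "is_coproduct C {0, 1 :: nat} (\<lambda>n. Dom C (?inc' n)) (Dom C \<pi>) ?inc'"
    by (rule pretopos_coproduct_stable[OF pt _ cop, where p = "\<lambda>n. if n = 0 then a else b"])
      (use pbi pbj in auto)
  have hf: "q' \<cdot> (i' \<cdot> f') = l" using Comp_extend[OF i'(5), of f'] f' by simp
  have kg: "q' \<cdot> (j' \<cdot> g') = l" using Comp_extend[OF j'(5), of g'] g' by simp
  have e': "is_pullback C e l (q \<cdot> (j \<cdot> g)) x" using e q(3) by simp
  have traceF: "\<pi> \<cdot> (i' \<cdot> f') = i \<cdot> (f \<cdot> e)"
    "\<And>c Y s. c \<in> Hom C Y (Dom C f) \<Longrightarrow> s \<in> Hom C Y (Dom C \<pi>) \<Longrightarrow> \<pi> \<cdot> s = i \<cdot> (f \<cdot> c) \<Longrightarrow>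
      \<exists>c' \<in> Hom C Y (Dom C e). e \<cdot> c' = c \<and> l \<cdot> c' = q' \<cdot> s \<and> i' \<cdot> (f' \<cdot> c') = s"
    by (rule is_pullback_trace[OF pq e, where a = a]; use i' f' hf in simp)+
  have traceG: "\<pi> \<cdot> (j' \<cdot> g') = j \<cdot> (g \<cdot> e)"
    "\<And>c Y s. c \<in> Hom C Y (Dom C f) \<Longrightarrow> s \<in> Hom C Y (Dom C \<pi>) \<Longrightarrow> \<pi> \<cdot> s = j \<cdot> (g \<cdot> c) \<Longrightarrow>
      \<exists>c' \<in> Hom C Y (Dom C e). e \<cdot> c' = c \<and> l \<cdot> c' = q' \<cdot> s \<and> j' \<cdot> (g' \<cdot> c') = s"
    by (rule is_pullback_trace[OF pq e', where a = b]; use j' g' kg in simp)+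
  obtain r s where rs: "is_pullback C r s q' q'" using pullback_exists[OF fc, of q' q'] by auto
  note [simp] = is_pullback_comm(1,2,5-7)[OF rs]
  have co: "is_coequalizer C r s q'"
    by (rule is_coequalizer_pushout[OF regular_epi_kernel_pair_pushout[OF fc q' rs]])
  show ?thesis
  proof (rule is_pushoutI)
    show "comm_square C f' g' h' k'" using f' g' by (simp add: comm_square_def)
    fix T
    { fix u v assume "u \<in> Hom C (Cod C f') T" "v \<in> Hom C (Cod C g') T" and uv: "u \<cdot> f' = v \<cdot> g'"
      then have [simp]: "u \<in> Arr C" "Dom C u = Dom C a" "Cod C u = T"
        "v \<in> Arr C" "Dom C v = Dom C b" "Cod C v = T" by simp_all
      have T: "T \<in> Obj C" using Cod_in_Obj[of u] by simp
      have tn: "(if n = 0 then u else v) \<in> Hom C (Dom C (?inc' n)) T" for n by simp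
      obtain t where t: "t \<in> Arr C" "Dom C t = Dom C \<pi>" "Cod C t = T"
        "\<And>n. n \<in> {0, 1} \<Longrightarrow> t \<cdot> ?inc' n = (if n = 0 then u else v)"
        using is_coproduct_lift[OF cop' T tn] by blast
      have ti: "t \<cdot> i' = u" and tj: "t \<cdot> j' = v" using t(4)[of 0] t(4)[of 1] by simp_all
      note [simp] = t(1-3)
      have agree: "t \<cdot> (i' \<cdot> (f' \<cdot> c)) = t \<cdot> (j' \<cdot> (g' \<cdot> c))" if "c \<in> Hom C Y (Dom C e)" for c Y
        using Comp_extend[OF ti, of "f' \<cdot> c"] Comp_extend[OF tj, of "g' \<cdot> c"] Comp_extend[OF uv, of c] that
        by simp
      \<comment> \<open>The projection \<open>\<pi>\<close> carries the kernel pair of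
        \<open>q'\<close> into that of \<open>q\<close>, where \<open>cov\<close> applies.\<close>
      have "q \<cdot> (\<pi> \<cdot> r) = q \<cdot> (\<pi> \<cdot> s)"
        using Comp_extend[OF is_pullback_comm(9)[OF pq], of r] Comp_extend[OF is_pullback_comm(9)[OF pq], of s]
          is_pullback_comm(9)[OF rs] by simp
      then have cover: "covers (Dom C r) (\<lambda>x. span_rel f g i j (Dom C x) ((\<pi> \<cdot> r) \<cdot> x) ((\<pi> \<cdot> s) \<cdot> x))"
        by (intro cov) simp_all
      have "t \<cdot> r = t \<cdot> s"
      proof (rule covers_eqI[OF cover, of _ T])
        fix Y y assume "y \<in> Hom C Y (Dom C r)"
          and "span_rel f g i j (Dom C y) ((\<pi> \<cdot> r) \<cdot> y) ((\<pi> \<cdot> s) \<cdot> y)"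
        then have y [simp]: "y \<in> Arr C" "Dom C y = Y" "Cod C y = Dom C r"
          and rel: "span_rel f g i j Y (\<pi> \<cdot> (r \<cdot> y)) (\<pi> \<cdot> (s \<cdot> y))" by simp_all
        have qrs: "q' \<cdot> (s \<cdot> y) = q' \<cdot> (r \<cdot> y)"
          using Comp_extend[OF is_pullback_comm(9)[OF rs], of y] by simp
        have ry: "r \<cdot> y \<in> Hom C Y (Dom C \<pi>)" "s \<cdot> y \<in> Hom C Y (Dom C \<pi>)" by simp_all
        have same: "m = n" if "m \<in> Hom C Y (Dom C e)" "n \<in> Hom C Y (Dom C e)"
          "e \<cdot> m = e \<cdot> n" "l \<cdot> m = l \<cdot> n" for m n
          using is_pullback_eqI[OF e that] .
        have "t \<cdot> (r \<cdot> y) = t \<cdot> (s \<cdot> y)"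
          using rel
        proof cases
          case refl
          have "r \<cdot> y = s \<cdot> y" by (rule is_pullback_eqI[OF pq, of _ Y]) (use refl qrs in simp_all)
          then show ?thesis by simp
        next
          case (FG c)
          obtain m where m: "m \<in> Hom C Y (Dom C e)" "e \<cdot> m = c" "l \<cdot> m = q' \<cdot> (r \<cdot> y)" "i' \<cdot> (f' \<cdot> m) = r \<cdot> y"
            using traceF(2)[OF FG(1) ry(1) FG(2)] by blast
          obtain n where n: "n \<in> Hom C Y (Dom C e)" "e \<cdot> n = c" "l \<cdot> n = q' \<cdot> (s \<cdot> y)" "j' \<cdot> (g' \<cdot> n) = s \<cdot> y"
            using traceG(2)[OF FG(1) ry(2) FG(3)] by blast
          \<comment> \<open>Both traces lie over the same \<open>c\<close> and, by
            \<open>qrs\<close>, over the same element of \<open>Dom C x\<close>. Then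
            \<open>agree\<close> transfers \<open>t\<close> from one leg to the other.\<close>
          have "m = n" using same m n qrs by metis
          then show ?thesis using agree[OF m(1)] m n by simp
        next
          case (GF c)
          obtain m where m: "m \<in> Hom C Y (Dom C e)" "e \<cdot> m = c" "l \<cdot> m = q' \<cdot> (r \<cdot> y)" "j' \<cdot> (g' \<cdot> m) = r \<cdot> y"
            using traceG(2)[OF GF(1) ry(1) GF(2)] by blast
          obtain n where n: "n \<in> Hom C Y (Dom C e)" "e \<cdot> n = c" "l \<cdot> n = q' \<cdot> (s \<cdot> y)" "i' \<cdot> (f' \<cdot> n) = s \<cdot> y"
            using traceF(2)[OF GF(1) ry(2) GF(3)] by blast
          have "m = n" using same m n qrs by metis
          then show ?thesis using agree[OF m(1)] m n by simp
        next
          case (FF c c')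
          obtain m where m: "m \<in> Hom C Y (Dom C e)" "e \<cdot> m = c" "l \<cdot> m = q' \<cdot> (r \<cdot> y)" "i' \<cdot> (f' \<cdot> m) = r \<cdot> y"
            using traceF(2)[OF FF(1) ry(1) FF(4)] by blast
          obtain n where n: "n \<in> Hom C Y (Dom C e)" "e \<cdot> n = c'" "l \<cdot> n = q' \<cdot> (s \<cdot> y)" "i' \<cdot> (f' \<cdot> n) = s \<cdot> y"
            using traceF(2)[OF FF(2) ry(2) FF(5)] by blast
          \<comment> \<open>The traces of \<open>c\<close> and \<open>c'\<close> may differ, but
            their other legs agree after \<open>\<pi>\<close> because
            \<open>j \<cdot> (g \<cdot> c) = j \<cdot> (g \<cdot> c')\<close>, and after
            \<open>q'\<close> by \<open>qrs\<close>. So \<open>t\<close> is compared by crossing to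
            the other summand and back.\<close>
          have "j' \<cdot> (g' \<cdot> m) = j' \<cdot> (g' \<cdot> n)"
            by (rule is_pullback_eqI[OF pq, of _ Y])
              (use m n FF(3) qrs Comp_extend[OF traceG(1), of m] Comp_extend[OF traceG(1), of n]
                Comp_extend[OF kg, of m] Comp_extend[OF kg, of n] in simp_all)
          then show ?thesis using agree[OF m(1)] agree[OF n(1)] m n by simp
        next
          case (GG c c')
          obtain m where m: "m \<in> Hom C Y (Dom C e)" "e \<cdot> m = c" "l \<cdot> m = q' \<cdot> (r \<cdot> y)" "j' \<cdot> (g' \<cdot> m) = r \<cdot> y"
            using traceG(2)[OF GG(1) ry(1) GG(4)] by blast
          obtain n where n: "n \<in> Hom C Y (Dom C e)" "e \<cdot> n = c'" "l \<cdot> n = q' \<cdot> (s \<cdot> y)" "j' \<cdot> (g' \<cdot> n) = s \<cdot> y"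
            using traceG(2)[OF GG(2) ry(2) GG(5)] by blast
          have "i' \<cdot> (f' \<cdot> m) = i' \<cdot> (f' \<cdot> n)"
            by (rule is_pullback_eqI[OF pq, of _ Y])
              (use m n GG(3) qrs Comp_extend[OF traceF(1), of m] Comp_extend[OF traceF(1), of n]
                Comp_extend[OF hf, of m] Comp_extend[OF hf, of n] in simp_all)
          then show ?thesis using agree[OF m(1)] agree[OF n(1)] m n by simp
        qed
        then show "(t \<cdot> r) \<cdot> y = (t \<cdot> s) \<cdot> y" by simp
      qed simp_all
      then obtain w where w: "w \<in> Arr C" "Dom C w = Cod C q'" "Cod C w = T" "w \<cdot> q' = t"
        by (rule is_coequalizer_lift[OF co, of t T, rotated]) simp_all
      have "w \<cdot> h' = u" "w \<cdot> k' = v"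
        using Comp_extend[OF w(4), of i'] Comp_extend[OF w(4), of j'] w i'(5) j'(5) ti tj by simp_all
      then show "\<exists>w\<in>Hom C (Cod C h') T. w \<cdot> h' = u \<and> w \<cdot> k' = v"
        using w by (intro bexI[of _ w]) simp_all }
    { fix w w' assume "w \<in> Hom C (Cod C h') T" "w' \<in> Hom C (Cod C h') T"
        and eq: "w \<cdot> h' = w' \<cdot> h'" "w \<cdot> k' = w' \<cdot> k'"
      then have [simp]: "w \<in> Arr C" "Dom C w = Dom C x" "Cod C w = T"
        "w' \<in> Arr C" "Dom C w' = Dom C x" "Cod C w' = T" by simp_all
      have "w \<cdot> q' = w' \<cdot> q'"
      proof (rule is_coproduct_eqI[OF cop', of _ T])
        fix n assume "n \<in> {0, 1 :: nat}"
        show "(w \<cdot> q') \<cdot> ?inc' n = (w' \<cdot> q') \<cdot> ?inc' n" using i'(5) j'(5) eq by simp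
      qed simp_all
      then show "w = w'" by (intro regular_epi_epi[OF q', of w T w']) simp_all }
  qed
qed

lemma pretopos_malcev_pushout:
  assumes mal: "malcev_span C f g"
  obtains h k where "stable_pushout C f g h k" "is_pullback C f g h k"
proof -
  have jm: "jointly_monic C f g" using mal by (simp add: malcev_span_def)
  note fg [simp] = jointly_monic_span[OF jm]
  obtain S i j q where
    cop: "is_coproduct C {0, 1 :: nat} (\<lambda>n. if n = 0 then Cod C f else Cod C g) S (\<lambda>n. if n = 0 then i else j)"
    and mono: "monic C i" "monic C j"
    and disj: "\<And>X u v. u \<in> Hom C X (Cod C f) \<Longrightarrow> v \<in> Hom C X (Cod C g) \<Longrightarrow> i \<cdot> u = j \<cdot> v \<Longrightarrow> is_initial C X"
    and q: "regular_epi C q" "Dom C q = S" "q \<cdot> (i \<cdot> f) = q \<cdot> (j \<cdot> g)"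
    and cov: "\<And>X u v. u \<in> Hom C X S \<Longrightarrow> v \<in> Hom C X S \<Longrightarrow> q \<cdot> u = q \<cdot> v \<Longrightarrow>
      covers X (\<lambda>x. span_rel f g i j (Dom C x) (u \<cdot> x) (v \<cdot> x))"
    by (rule malcev_quotient[OF pt mal]) (rule that; (assumption | blast))
  note [simp] = q(2) regular_epi_Arr[OF q(1)]
  have [simp]: "i \<in> Arr C" "Dom C i = Cod C f" "Cod C i = S" "j \<in> Arr C" "Dom C j = Cod C g" "Cod C j = S"
    using is_coproductD(3-5)[OF cop, of 0] is_coproductD(3-5)[OF cop, of 1] by simp_all
  note pulled = quotient_pullback_pushout[OF fg cop q cov]
  \<comment> \<open>Base change along the identity of \<open>Cod C q\<close>.\<close>
  have po: "is_pushout C f g (q \<cdot> i) (q \<cdot> j)"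
  proof (rule pulled)
    show "is_pullback C (Id C (Cod C f)) (q \<cdot> i) (q \<cdot> i) (Id C (Cod C q))"
      "is_pullback C (Id C (Cod C g)) (q \<cdot> j) (q \<cdot> j) (Id C (Cod C q))"
      "is_pullback C (Id C (Dom C f)) (q \<cdot> (i \<cdot> f)) (q \<cdot> (i \<cdot> f)) (Id C (Cod C q))"
      using is_pullback_Id[of "q \<cdot> i"] is_pullback_Id[of "q \<cdot> j"] is_pullback_Id[of "q \<cdot> (i \<cdot> f)"] by simp_all
  qed (use q(3) in simp_all)
  have "stable_pushout C f g (q \<cdot> i) (q \<cdot> j)"
    unfolding stable_pushout_def
  proof (intro conjI po allI impI; elim conjE)
    fix x a h' b k' c l f' g'
    assume *: "is_pullback C a h' (q \<cdot> i) x" "is_pullback C b k' (q \<cdot> j) x"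
      and c: "is_pullback C c l ((q \<cdot> i) \<cdot> f) x"
      and **: "f' \<in> Hom C (Dom C c) (Dom C a)" "a \<cdot> f' = f \<cdot> c" "h' \<cdot> f' = l"
        "g' \<in> Hom C (Dom C c) (Dom C b)" "b \<cdot> g' = g \<cdot> c" "k' \<cdot> g' = l"
    have c': "is_pullback C c l (q \<cdot> (i \<cdot> f)) x" using c by simp
    show "is_pushout C f' g' h' k'" by (rule pulled[OF _ _ _ * c' **])
  qed
  moreover have "is_pullback C f g (q \<cdot> i) (q \<cdot> j)"
  proof (rule is_pullbackI)
    show "comm_square C f g (q \<cdot> i) (q \<cdot> j)" using po unfolding is_pushout_def by blast
    fix X
    { fix u v assume "u \<in> Hom C X (Dom C (q \<cdot> i))" "v \<in> Hom C X (Dom C (q \<cdot> j))"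
        and eq: "(q \<cdot> i) \<cdot> u = (q \<cdot> j) \<cdot> v"
      then have [simp]: "u \<in> Arr C" "Dom C u = X" "Cod C u = Cod C f" "v \<in> Arr C" "Dom C v = X" "Cod C v = Cod C g"
        by simp_all
      \<comment> \<open>It is enough to lift \<open>u\<close>, \<open>v\<close> to the span on this
        cover, because the span is jointly monic. At a non-initial stage disjointness excludes every
        generator except \<open>FG\<close>, which provides the lift.\<close>
      have cover: "covers X (\<lambda>x. span_rel f g i j (Dom C x) ((i \<cdot> u) \<cdot> x) ((j \<cdot> v) \<cdot> x))"
        by (rule cov) (use eq in simp_all)
      show "\<exists>w\<in>Hom C X (Dom C f). f \<cdot> w = u \<and> g \<cdot> w = v"
      proof (rule covers_lift[OF cover jm])
        fix Y y assume "y \<in> Hom C Y X"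
          and "span_rel f g i j (Dom C y) ((i \<cdot> u) \<cdot> y) ((j \<cdot> v) \<cdot> y)"
        then have [simp]: "y \<in> Arr C" "Dom C y = Y" "Cod C y = X"
          and rel: "span_rel f g i j Y (i \<cdot> (u \<cdot> y)) (j \<cdot> (v \<cdot> y))" by simp_all
        show "\<exists>w\<in>Hom C Y (Dom C f). f \<cdot> w = u \<cdot> y \<and> g \<cdot> w = v \<cdot> y"
        proof (cases "is_initial C Y")
          case True
          have "Dom C f \<in> Obj C" by simp
          then obtain w where w: "w \<in> Arr C" "Dom C w = Y" "Cod C w = Dom C f"
            by (rule is_initial_lift[OF True])
          have "f \<cdot> w = u \<cdot> y" by (rule is_initial_eqI[OF True, of _ "Cod C f"]) (use w in simp_all)
          moreover have "g \<cdot> w = v \<cdot> y" by (rule is_initial_eqI[OF True, of _ "Cod C g"]) (use w in simp_all)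
          ultimately show ?thesis using w by (intro bexI[of _ w]) simp_all
        next
          case False
          then have ne: "i \<cdot> m \<noteq> j \<cdot> n" if "m \<in> Hom C Y (Cod C f)" "n \<in> Hom C Y (Cod C g)" for m n
            using disj that by blast
          show ?thesis
            using rel
          proof cases
            case refl
            then show ?thesis using ne[of "u \<cdot> y" "v \<cdot> y"] by simp
          next
            case (FG c)
            have "u \<cdot> y = f \<cdot> c" by (rule monicD[OF mono(1), of _ Y]) (use FG in simp_all)
            moreover have "v \<cdot> y = g \<cdot> c" by (rule monicD[OF mono(2), of _ Y]) (use FG in simp_all)
            ultimately show ?thesis using FG by (intro bexI[of _ c]) simp_all
          next
            case (GF c)
            then show ?thesis using ne[of "u \<cdot> y" "g \<cdot> c"] by simp
          next
            case (FF c c')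
            then show ?thesis using ne[of "f \<cdot> c'" "v \<cdot> y"] by simp
          next
            case (GG c c')
            then show ?thesis using ne[of "u \<cdot> y" "g \<cdot> c"] by simp
          qed
        qed
      qed simp_all }
    { fix w w' assume "w \<in> Hom C X (Dom C f)" "w' \<in> Hom C X (Dom C f)" "f \<cdot> w = f \<cdot> w'" "g \<cdot> w = g \<cdot> w'"
      then show "w = w'" by (rule jointly_monicD[OF jm]) }
  qed
  ultimately show ?thesis using that by blast
qed

lemma pretopos_diexact: "diexact C"
  unfolding diexact_def
proof (intro conjI allI impI)
  show "finitely_complete C" by (rule pretopos_finitely_complete[OF pt])
  fix f g assume mal: "malcev_span C f g"
  obtain h k where stable: "stable_pushout C f g h k" and pb: "is_pullback C f g h k"
    by (rule pretopos_malcev_pushout[OF mal])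
  have po: "is_pushout C f g h k" using stable by (simp add: stable_pushout_def)
  then show "\<exists>h k. is_pushout C f g h k" by blast
  fix h2 k2 assume po2: "is_pushout C f g h2 k2"
  obtain w w' where w: "w \<in> Arr C" "Dom C w = Cod C h2" "Cod C w = Cod C h"
    and w': "w' \<in> Arr C" "Dom C w' = Cod C w" and wh: "w \<cdot> h2 = h" "w \<cdot> k2 = k"
    and inv: "w' \<cdot> w = Id C (Cod C h2)"
    using is_pushout_unique[OF po po2] by (metis Hom_iff)
  note [simp] = is_pushout_comm(1-8)[OF po2] w
  show "stable_pushout C f g h2 k2"
    unfolding stable_pushout_def
  proof (intro conjI po2 allI impI; elim conjE)
    fix x a h' b k' c l f' g'
    assume pb: "is_pullback C a h' h2 x" "is_pullback C b k' k2 x" "is_pullback C c l (h2 \<cdot> f) x"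
      and f'g': "f' \<in> Hom C (Dom C c) (Dom C a)" "a \<cdot> f' = f \<cdot> c" "h' \<cdot> f' = l"
        "g' \<in> Hom C (Dom C c) (Dom C b)" "b \<cdot> g' = g \<cdot> c" "k' \<cdot> g' = l"
    \<comment> \<open>Pulling the second pushout back along \<open>x\<close> is the same as pulling
      the constructed one back along \<open>w \<cdot> x\<close>.\<close>
    have "is_pullback C a h' h (w \<cdot> x)" "is_pullback C b k' k (w \<cdot> x)"
      using is_pullback_split_mono_comp[OF pb(1) _ _ w'] is_pullback_split_mono_comp[OF pb(2) _ _ w'] inv wh
      by simp_all
    moreover have "is_pullback C c l (h \<cdot> f) (w \<cdot> x)"
      using is_pullback_split_mono_comp[OF pb(3) _ _ w'] inv Comp_extend[OF wh(1), of f] by simp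
    ultimately show "is_pushout C f' g' h' k'"
      using stable f'g' unfolding stable_pushout_def by blast
  qed
  show "is_pullback C f g h2 k2"
  proof (rule is_pullbackI)
    show "comm_square C f g h2 k2" using po2 unfolding is_pushout_def by blast
    fix X
    { fix u v assume uv: "u \<in> Hom C X (Dom C h2)" "v \<in> Hom C X (Dom C k2)" "h2 \<cdot> u = k2 \<cdot> v"
      have "h \<cdot> u = k \<cdot> v" using uv Comp_extend[OF wh(1), of u] Comp_extend[OF wh(2), of v] by simp
      then show "\<exists>w\<in>Hom C X (Dom C f). f \<cdot> w = u \<and> g \<cdot> w = v"
        using is_pullback_lift[OF pb, of u X v] uv is_pushout_comm(6,7)[OF po] is_pushout_comm(6,7)[OF po2]
        by (metis Hom_iff) }
    { fix w w' assume "w \<in> Hom C X (Dom C f)" "w' \<in> Hom C X (Dom C f)" "f \<cdot> w = f \<cdot> w'" "g \<cdot> w = g \<cdot> w'"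
      then show "w = w'" by (rule is_pullback_eqI[OF pb]) }
  qed
qed

end
end

theorem theorem1:
  fixes C :: "('o, 'a) cat"
  assumes "category C"
    and "finitely_complete C"
  shows "pretopos C \<longleftrightarrow> diexact C \<and> (\<exists>Z. is_strict_initial C Z)"
proof -
  interpret category C by fact
  show ?thesis
    using pretopos_diexact pretopos_strict_initial diexact_extensive diexact_barr_exact assms(2)
    unfolding pretopos_def by blast
qed

end
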